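(* Let $\Gamma$ be a connected graph with first $\mathbb{Z}_2$-Betti number $b=\dim_{\mathbb{Z}_2}H_1(\Gamma;\mathbb{Z}_2)\ge 2$. Then there exist cycles $\gamma_1,\dots,\gamma_b$ in $\Gamma$ whose classes form a basis of $H_1(\Gamma;\mathbb{Z}_2)$ and such that $$\prod_{k=1}^{b}\ell(\gamma_k)\le\left(4e\log_2 b\right)^b\cdot\left(\frac{\ell(\Gamma)}{b}\right)^b.$$
   Context: A graph is a finite simplicial complex of dimension $1$. The length $\ell$ of a subgraph (such as a cycle, or $\Gamma$ itself) is the number of its edges. A cycle is a closed embedded path of edges. *)

theory Defs
  imports Complex_Main "HOL-Library.Z2" "HOL-Library.Function_Algebras"
begin

text \<open>
  An abstract finite simplicial complex is given by its set of simplices; a simplex is a nonempty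
  finite vertex set.
\<close>

definition simplicial_complex :: "'a set set \<Rightarrow> bool" where
  "simplicial_complex K \<longleftrightarrow>
     finite K \<and> (\<forall>\<sigma>\<in>K. finite \<sigma> \<and> \<sigma> \<noteq> {}) \<and> (\<forall>\<sigma>\<in>K. \<forall>\<tau>. \<tau> \<noteq> {} \<and> \<tau> \<subseteq> \<sigma> \<longrightarrow> \<tau> \<in> K)"

definition simplices :: "'a set set \<Rightarrow> nat \<Rightarrow> 'a set set" where
  "simplices K k = {\<sigma> \<in> K. card \<sigma> = Suc k}"

definition graph :: "'a set set \<Rightarrow> bool" where
  "graph K \<longleftrightarrow> simplicial_complex K \<and> simplices K 1 \<noteq> {} \<and> (\<forall>k>1. simplices K k = {})"

definition connected_graph :: "'a set set \<Rightarrow> bool" where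
  "connected_graph K \<longleftrightarrow>
     graph K \<and> (\<forall>u\<in>\<Union>K. \<forall>v\<in>\<Union>K. (u, v) \<in> {(x, y). {x, y} \<in> simplices K 1}\<^sup>*)"

definition len :: "'a set set \<Rightarrow> nat" where
  "len K = card (simplices K 1)"

text \<open>
  A cycle is a subcomplex. It is described by its cyclic sequence of pairwise distinct vertices;
  as there are no loops or multiple edges, an embedded closed path has at least three of them.
\<close>

definition closed_path_complex :: "'a list \<Rightarrow> 'a set set" where
  "closed_path_complex vs =
     (\<lambda>v. {v}) ` set vs \<union> (\<lambda>i. {vs ! i, vs ! (Suc i mod length vs)}) ` {..<length vs}"

definition cycle_in :: "'a set set \<Rightarrow> 'a set set \<Rightarrow> bool" where
  "cycle_in K \<gamma> \<longleftrightarrow>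
     (\<exists>vs. 3 \<le> length vs \<and> distinct vs \<and> \<gamma> = closed_path_complex vs \<and> \<gamma> \<subseteq> K)"

text \<open>
  Simplicial chains with coefficients in the field \<open>bit\<close> of two elements: functions on simplices,
  extended by \<open>0\<close> to all sets so that they live in a vector space on a type.
\<close>

interpretation Z2: vector_space "\<lambda>(a::bit) (c::'a set \<Rightarrow> bit). (\<lambda>\<sigma>. a * c \<sigma>)"
  by unfold_locales (auto simp: fun_eq_iff algebra_simps)

definition chains :: "'a set set \<Rightarrow> nat \<Rightarrow> ('a set \<Rightarrow> bit) set" where
  "chains K k = {c. \<forall>\<sigma>. \<sigma> \<notin> simplices K k \<longrightarrow> c \<sigma> = 0}"

text \<open>The boundary operator from \<open>(k + 1)\<close>-chains to \<open>k\<close>-chains.\<close>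

definition boundary :: "'a set set \<Rightarrow> nat \<Rightarrow> ('a set \<Rightarrow> bit) \<Rightarrow> ('a set \<Rightarrow> bit)" where
  "boundary K k c =
     (\<lambda>\<tau>. if \<tau> \<in> simplices K k then \<Sum>\<sigma> | \<sigma> \<in> simplices K (Suc k) \<and> \<tau> \<subseteq> \<sigma>. c \<sigma> else 0)"

text \<open>
  A graph has no 2-simplices, so its only 1-dimensional boundary is \<open>0\<close> (see
  \<open>graph_boundaries_trivial\<close>), and the quotient defining the first homology of a graph is the
  kernel of the boundary operator itself; a homology class is the 1-chain representing it.
\<close>

definition H1 :: "'a set set \<Rightarrow> ('a set \<Rightarrow> bit) set" where
  "H1 K = {c \<in> chains K 1. boundary K 0 c = 0}"

lemma graph_boundaries_trivial:
  assumes "graph K"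
  shows "boundary K 1 ` chains K 2 = {0}"
proof -
  have "simplices K 2 = {}"
    using assms by (simp add: graph_def)
  then have "chains K 2 = {0}"
    by (auto simp: chains_def fun_eq_iff)
  then show ?thesis
    by (auto simp: boundary_def fun_eq_iff)
qed

definition betti1 :: "'a set set \<Rightarrow> nat" where
  "betti1 K = Z2.dim (H1 K)"

definition fundamental_class :: "'a set set \<Rightarrow> ('a set \<Rightarrow> bit)" where
  "fundamental_class \<gamma> = (\<lambda>\<sigma>. if \<sigma> \<in> simplices \<gamma> 1 then 1 else 0)"

definition is_basis_of :: "('i \<Rightarrow> 'a set \<Rightarrow> bit) \<Rightarrow> 'i set \<Rightarrow> ('a set \<Rightarrow> bit) set \<Rightarrow> bool" where
  "is_basis_of c I V \<longleftrightarrow> inj_on c I \<and> Z2.independent (c ` I) \<and> Z2.span (c ` I) = V"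

end

theory Submission
  imports Defs "HOL-Analysis.Harmonic_Numbers"
begin

text \<open>
  Choose the cycles greedily: take a short cycle, remove one of its edges, which lowers the Betti
  number by one, and repeat. The removed edges make the classes independent. If the cycle found
  at Betti number \<open>k\<close> has length at most \<open>4 log\<^sub>2 b \<cdot> \<ell> / k\<close>, the product is at most
  \<open>(4 log\<^sub>2 b \<cdot> \<ell>) ^ b / b!\<close>, and \<open>b! \<ge> (b / e) ^ b\<close>.

  For the short cycle, delete leaves and suppress vertices of degree two; this leads to weighted
  multigraphs of minimum degree three. There the uniform distribution on oriented edges is
  stationary for the non-backtracking random walk, so some vertex starts walks of small expected
  weight, while each single walk with \<open>n\<close> branchings has probability at most \<open>2 ^ (-n)\<close>. Once
  \<open>2 ^ n\<close> exceeds the number of vertices by a constant factor, two light walks from that vertex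
  have the same end, and their union contains a cycle.
\<close>

section \<open>Non-backtracking walks in multigraphs\<close>

text \<open>A loop counts twice, so that \<open>mdeg\<close> agrees with the number of darts leaving
  the vertex (\<open>card_out\<close>).\<close>

definition mdeg :: "('e \<Rightarrow> 'v) \<Rightarrow> ('e \<Rightarrow> 'v) \<Rightarrow> 'e set \<Rightarrow> 'v \<Rightarrow> nat" where
  "mdeg s t F v = (\<Sum>e\<in>F. of_bool (s e = v) + of_bool (t e = v))"

text \<open>Evenness is the form in which cycles survive the suppression of vertices, where loops
  and parallel edges arise. A genuine cycle is extracted only in the simplicial graph, by
  \<open>cycle_in_min_degree_2\<close>.\<close>

definition even_subgraph :: "('e \<Rightarrow> 'v) \<Rightarrow> ('e \<Rightarrow> 'v) \<Rightarrow> 'e set \<Rightarrow> bool" where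
  "even_subgraph s t F \<longleftrightarrow> (\<forall>v. even (mdeg s t F v))"

text \<open>
  A dart is an edge with one of its two orientations, so that a loop has two darts.
\<close>

fun opp :: "'e \<times> bool \<Rightarrow> 'e \<times> bool" where
  "opp (e, b) = (e, \<not> b)"

lemma opp_opp [simp]: "opp (opp d) = d"
  by (cases d) auto

lemma fst_opp [simp]: "fst (opp d) = fst d"
  by (cases d) auto

lemma opp_neq [simp]: "opp d \<noteq> d" "d \<noteq> opp d"
  by (cases d; auto)+

lemma fst_eqD: "fst d = fst d' \<Longrightarrow> d = d' \<or> d' = opp d"
  by (cases d; cases d') auto

locale multigraph =
  fixes s t :: "'e \<Rightarrow> 'v"
begin

definition src :: "'e \<times> bool \<Rightarrow> 'v" where
  "src d = (if snd d then s (fst d) else t (fst d))"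

definition tgt :: "'e \<times> bool \<Rightarrow> 'v" where
  "tgt d = src (opp d)"

definition nb_step :: "'e \<times> bool \<Rightarrow> 'e \<times> bool \<Rightarrow> bool" where
  "nb_step d d' \<longleftrightarrow> src d' = tgt d \<and> d' \<noteq> opp d"

lemma tgt_opp [simp]: "tgt (opp d) = src d"
  by (simp add: tgt_def)

lemma src_opp [simp]: "src (opp d) = tgt d"
  by (simp add: tgt_def)

lemma ends_eq: 
  "of_bool (s (fst d) = v) + of_bool (t (fst d) = v) = (of_bool (src d = v) + of_bool (tgt d = v) :: nat)"
  by (cases d) (auto simp: src_def tgt_def)

lemma nb_step_opp: "nb_step (opp d') (opp d) \<longleftrightarrow> nb_step d d'"
  by (auto simp: nb_step_def)

lemma map_tgt_walk:
  "successively nb_step (x # q) \<Longrightarrow> map tgt (x # q) = map src q @ [tgt (last (x # q))]"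
  by (induction q arbitrary: x) (auto simp: nb_step_def)

lemma walk_src_after:
  assumes "successively nb_step (a @ x # c)" "a \<noteq> []"
  shows "src x = tgt (last a)"
  using assms by (auto simp: successively_append_iff nb_step_def)

text \<open>No edge is used twice: darts \<open>z\<close> and \<open>opp z\<close> are either
  adjacent, which is backtracking, or the dart after the first one has the same source as the second
  one. In a closed walk each vertex is a source as often as a target, so all degrees are
  even.\<close>

lemma even_subgraph_of_simple_closed_walk:
  assumes nb: "successively nb_step q" and ne: "q \<noteq> []"
    and cl: "src (hd q) = tgt (last q)" and dist: "distinct (map src q)"
  shows "even_subgraph s t (fst ` set q)"
proof -
  have inj: "inj_on fst (set q)"
  proof (rule inj_onI, rule ccontr)
    fix x y assume xy: "x \<in> set q" "y \<in> set q" "fst x = fst y" "x \<noteq> y"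
    have no: False if "q = a @ z # c @ opp z # d" for a z c d
    proof (cases c)
      case Nil
      with that nb show False by (auto simp: successively_append_iff nb_step_def)
    next
      case (Cons u c')
      with that nb have "src u = tgt z" by (auto simp: successively_append_iff nb_step_def)
      with that Cons dist show False by auto
    qed
    have y: "y = opp x" using fst_eqD[OF xy(3)] xy(4) by auto
    obtain a c where q: "q = a @ x # c" using xy(1) split_list by metis
    have "y \<in> set a \<or> y \<in> set c" using xy q by auto
    then show False
    proof
      assume "y \<in> set a"
      then obtain a1 a2 where "a = a1 @ y # a2" using split_list by metis
      with q y no[of a1 y a2 c] show False by auto
    next
      assume "y \<in> set c"
      then obtain a1 a2 where "c = a1 @ y # a2" using split_list by metis
      with q y no[of a x a1 a2] show False by auto
    qed
  qed
  have dq: "distinct q" using dist by (simp add: distinct_map)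
  \<comment> \<open>Closing up makes the list of targets a rotation of the list of sources.\<close>
  have shift: "(\<Sum>u\<leftarrow>map tgt q. f u) = (\<Sum>u\<leftarrow>map src q. f u)" for f :: "'v \<Rightarrow> nat"
  proof -
    obtain x q' where q: "q = x # q'" using ne by (cases q) auto
    have "map tgt q = map src q' @ [src x]"
      using map_tgt_walk[of x q'] nb cl by (simp only: q list.sel)
    then show ?thesis by (simp add: q)
  qed
  have "mdeg s t (fst ` set q) v = 2 * (\<Sum>u\<leftarrow>map src q. of_bool (u = v))" for v
  proof -
    have "mdeg s t (fst ` set q) v = (\<Sum>d\<in>set q. of_bool (src d = v) + of_bool (tgt d = v))"
      unfolding mdeg_def by (subst sum.reindex[OF inj]) (simp add: ends_eq)
    also have "\<dots> = (\<Sum>d\<leftarrow>q. of_bool (src d = v) + of_bool (tgt d = v))"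
      using dq by (simp add: sum_list_distinct_conv_sum_set)
    also have "\<dots> = (\<Sum>u\<leftarrow>map src q. of_bool (u = v)) + (\<Sum>u\<leftarrow>map tgt q. of_bool (u = v))"
      by (simp add: sum_list_addf o_def)
    also have "(\<Sum>u\<leftarrow>map tgt q. of_bool (u = v)) = (\<Sum>u\<leftarrow>map src q. of_bool (u = v) :: nat)"
      by (rule shift)
    finally show ?thesis by simp
  qed
  then show ?thesis by (simp add: even_subgraph_def)
qed

text \<open>If a source repeats, the segment between its two occurrences is a shorter closed walk.
  Turning back is excluded only inside a walk and not where it closes up, so segments inherit the
  hypotheses.\<close>

lemma even_subgraph_of_closed_walk:
  assumes "successively nb_step q" "q \<noteq> []" "src (hd q) = tgt (last q)"
  shows "\<exists>F. F \<noteq> {} \<and> F \<subseteq> fst ` set q \<and> even_subgraph s t F"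
  using assms
proof (induction q rule: length_induct)
  case (1 q)
  show ?case
  proof (cases "distinct (map src q)")
    case True
    with 1(2-4) even_subgraph_of_simple_closed_walk[of q] show ?thesis
      by (intro exI[of _ "fst ` set q"]) auto
  next
    case False
    then obtain a c d u where "map src q = a @ [u] @ c @ [u] @ d"
      using not_distinct_decomp by metis
    then obtain a' x c' y d' where q: "q = a' @ x # c' @ y # d'" and xy: "src x = u" "src y = u"
      by (auto simp: map_eq_append_conv map_eq_Cons_conv append_eq_map_conv Cons_eq_map_conv)
    let ?p = "x # c'"
    have "successively nb_step (?p @ y # d')"
      using 1(2) unfolding q by (simp add: successively_append_iff)
    moreover from this have "src y = tgt (last ?p)" using walk_src_after[of ?p y d'] by simp
    ultimately have p: "successively nb_step ?p" "src (hd ?p) = tgt (last ?p)"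
      using xy by (auto simp only: successively_append_iff list.sel)
    moreover have "length ?p < length q" by (simp add: q)
    ultimately obtain F where "F \<noteq> {}" "F \<subseteq> fst ` set ?p" "even_subgraph s t F"
      using 1(1)[rule_format, of ?p] p by auto
    then show ?thesis unfolding q by (intro exI[of _ F]) auto
  qed
qed

lemma first_difference:
  "length p = length q \<Longrightarrow> p \<noteq> q \<Longrightarrow> \<exists>r x y p' q'. p = r @ x # p' \<and> q = r @ y # q' \<and> x \<noteq> y"
  by (metis same_length_different Cons_eq_appendI append_Nil append.assoc)

text \<open>Cut off the common prefix, follow the rest of \<open>q\<close> backwards and then the
  rest of \<open>p\<close>. The first differing darts \<open>x\<close> and \<open>y\<close> make the
  junction non-backtracking. The result closes up at the common end, where
  \<open>even_subgraph_of_closed_walk\<close> tolerates a turn back.\<close>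

lemma even_subgraph_of_two_walks:
  assumes p: "successively nb_step p" and q: "successively nb_step q"
    and len: "length p = length q" and neq: "p \<noteq> q"
    and st: "src (hd p) = src (hd q)" and en: "tgt (last p) = tgt (last q)"
  shows "\<exists>F. F \<noteq> {} \<and> F \<subseteq> fst ` (set p \<union> set q) \<and> even_subgraph s t F"
proof -
  obtain r x y p' q' where pq: "p = r @ x # p'" "q = r @ y # q'" "x \<noteq> y"
    using first_difference[OF len neq] by blast
  have "src x = src y"
    using walk_src_after p q st unfolding pq by (cases "r = []") auto
  define c where "c = map opp (rev (y # q')) @ (x # p')"
  have 1: "successively nb_step (x # p')" "successively nb_step (y # q')"
    using p q unfolding pq by (auto simp: successively_append_iff)
  have "successively nb_step (map opp (rev (y # q')))"
    unfolding successively_map successively_rev using 1(2) by (simp add: nb_step_opp)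
  then have "successively nb_step c"
    unfolding c_def successively_append_iff using 1(1) \<open>src x = src y\<close> pq(3)
    by (auto simp: nb_step_def)
  moreover have "src (hd c) = tgt (last c)"
  proof -
    have "hd c = opp (last (y # q'))"
      unfolding c_def by (simp add: hd_append hd_rev hd_map del: rev.simps)
    then show ?thesis using en by (simp add: c_def pq)
  qed
  ultimately obtain F where F: "F \<noteq> {}" "F \<subseteq> fst ` set c" "even_subgraph s t F"
    using even_subgraph_of_closed_walk[of c] by (auto simp: c_def)
  have "fst ` set c \<subseteq> fst ` (set p \<union> set q)"
    by (simp add: c_def pq image_image image_Un) blast
  with F show ?thesis by (meson order_trans)
qed

end

section \<open>Random non-backtracking walks in minimum degree three\<close>

locale min_degree_3_multigraph = multigraph s t for s t :: "'e \<Rightarrow> 'v" +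
  fixes V :: "'v set" and E :: "'e set" and w :: "'e \<Rightarrow> real"
  assumes finite_V: "finite V" and finite_E: "finite E" and E_nonempty: "E \<noteq> {}"
    and ends: "e \<in> E \<Longrightarrow> s e \<in> V" "e \<in> E \<Longrightarrow> t e \<in> V"
    and weight_pos: "e \<in> E \<Longrightarrow> 0 < w e"
    and deg_ge_3: "v \<in> V \<Longrightarrow> 3 \<le> mdeg s t E v"
begin

definition darts :: "('e \<times> bool) set" where
  "darts = E \<times> UNIV"

definition out :: "'v \<Rightarrow> ('e \<times> bool) set" where
  "out v = {d \<in> darts. src d = v}"

definition nxt :: "'e \<times> bool \<Rightarrow> ('e \<times> bool) set" where
  "nxt d = {d' \<in> darts. nb_step d d'}"

lemma finite_darts [simp]: "finite darts"
  by (simp add: darts_def finite_E)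

lemma finite_out [simp]: "finite (out v)"
  by (simp add: out_def)

lemma finite_nxt [simp]: "finite (nxt d)"
  by (simp add: nxt_def)

lemma opp_in_darts [simp]: "opp d \<in> darts \<longleftrightarrow> d \<in> darts"
  by (cases d) (simp add: darts_def)

lemma src_in_V: "d \<in> darts \<Longrightarrow> src d \<in> V"
  by (auto simp: darts_def src_def ends)

lemma tgt_in_V: "d \<in> darts \<Longrightarrow> tgt d \<in> V"
  unfolding tgt_def by (rule src_in_V) simp

lemma sum_darts: "(\<Sum>d\<in>darts. f (fst d)) = 2 * (\<Sum>e\<in>E. f e)" for f :: "'e \<Rightarrow> real"
proof -
  have "(\<Sum>d\<in>darts. f (fst d)) = (\<Sum>e\<in>E. \<Sum>b\<in>(UNIV :: bool set). f e)"
    unfolding darts_def by (subst sum.cartesian_product) (simp add: case_prod_unfold)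
  then show ?thesis by (simp add: sum_distrib_left)
qed

lemma card_out: "card (out v) = mdeg s t E v"
proof -
  have "out v = (\<lambda>e. (e, True)) ` {e \<in> E. s e = v} \<union> (\<lambda>e. (e, False)) ` {e \<in> E. t e = v}"
    by (auto simp: out_def darts_def src_def)
  also have "card \<dots> = card {e \<in> E. s e = v} + card {e \<in> E. t e = v}"
    by (subst card_Un_disjoint) (auto simp: finite_E card_image inj_on_def)
  finally show ?thesis
    using finite_E by (simp add: mdeg_def sum.distrib sum_of_bool_eq Int_def)
qed

lemma card_nxt:
  assumes "d \<in> darts"
  shows "card (nxt d) = mdeg s t E (tgt d) - 1"
proof -
  have "nxt d = out (tgt d) - {opp d}"
    by (auto simp: nxt_def out_def nb_step_def)
  moreover have "opp d \<in> out (tgt d)"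
    using assms by (simp add: out_def)
  ultimately show ?thesis by (simp add: card_out)
qed

lemma card_nxt_ge_2: "d \<in> darts \<Longrightarrow> 2 \<le> card (nxt d)"
  using deg_ge_3[OF tgt_in_V, of d] by (simp add: card_nxt)

text \<open>Reversal turns the predecessors of \<open>d'\<close> into the successors of
  \<open>opp d'\<close>. Together with \<open>card_nxt\<close> this count is what makes the uniform
  distribution stationary.\<close>

lemma card_prev:
  assumes "d' \<in> darts"
  shows "card {d \<in> darts. nb_step d d'} = mdeg s t E (src d') - 1"
proof -
  have "{d \<in> darts. nb_step d d'} = opp ` nxt (opp d')"
  proof (rule set_eqI)
    fix d
    have "d \<in> opp ` nxt (opp d') \<longleftrightarrow> opp d \<in> nxt (opp d')"
      by (auto intro: rev_image_eqI[of "opp d"])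
    then show "d \<in> {d \<in> darts. nb_step d d'} \<longleftrightarrow> d \<in> opp ` nxt (opp d')"
      by (simp add: nxt_def nb_step_opp)
  qed
  moreover have "inj_on opp X" for X :: "('e \<times> bool) set"
    by (rule inj_on_inverseI[of _ opp]) simp
  ultimately show ?thesis using assms by (simp add: card_image card_nxt)
qed

text \<open>The index counts branchings, so a walk in \<open>walks n d\<close> has
  \<open>Suc n\<close> darts.\<close>

fun walks :: "nat \<Rightarrow> 'e \<times> bool \<Rightarrow> ('e \<times> bool) list set" where
  "walks 0 d = {[d]}"
| "walks (Suc n) d = (\<Union>d'\<in>nxt d. (#) d ` walks n d')"

text \<open>The expected weight of a random non-backtracking walk that starts with the dart \<open>d\<close>.\<close>

fun mean_weight :: "nat \<Rightarrow> 'e \<times> bool \<Rightarrow> real" where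
  "mean_weight 0 d = w (fst d)"
| "mean_weight (Suc n) d = w (fst d) + (\<Sum>d'\<in>nxt d. mean_weight n d') / card (nxt d)"

definition weight :: "('e \<times> bool) list \<Rightarrow> real" where
  "weight p = (\<Sum>d\<leftarrow>p. w (fst d))"

definition light_walks :: "nat \<Rightarrow> real \<Rightarrow> 'e \<times> bool \<Rightarrow> ('e \<times> bool) list set" where
  "light_walks n L d = {p \<in> walks n d. weight p \<le> L}"

lemma finite_walks [simp]: "finite (walks n d)"
  by (induction n arbitrary: d) auto

lemma finite_light_walks [simp]: "finite (light_walks n L d)"
  by (simp add: light_walks_def)

lemma walksD:
  assumes "d \<in> darts" "p \<in> walks n d"
  shows "p \<noteq> [] \<and> hd p = d \<and> length p = Suc n \<and> set p \<subseteq> darts \<and> successively nb_step p"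
  using assms
proof (induction n arbitrary: d p)
  case (Suc n)
  then obtain d' p' where p: "p = d # p'" "d' \<in> nxt d" "p' \<in> walks n d'" by auto
  then have "d' \<in> darts" "nb_step d d'" by (auto simp: nxt_def)
  with Suc.IH[OF \<open>d' \<in> darts\<close> p(3)] p(1) Suc.prems(1) show ?case
    by (cases p') auto
qed auto

lemma light_walks_disjoint:
  "d \<in> darts \<Longrightarrow> d' \<in> darts \<Longrightarrow> d \<noteq> d' \<Longrightarrow> light_walks n L d \<inter> light_walks n L' d' = {}"
proof -
  assume d: "d \<in> darts" "d' \<in> darts" "d \<noteq> d'"
  have False if "p \<in> light_walks n L d" "p \<in> light_walks n L' d'" for p
    using walksD[OF d(1), of p n] walksD[OF d(2), of p n] d(3) that by (auto simp: light_walks_def)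
  then show ?thesis by blast
qed

lemma mean_weight_nonneg: "d \<in> darts \<Longrightarrow> 0 \<le> mean_weight n d"
proof (induction n arbitrary: d)
  case 0
  then show ?case using weight_pos[of "fst d"] by (auto simp: darts_def)
next
  case (Suc n)
  moreover have "0 \<le> (\<Sum>d'\<in>nxt d. mean_weight n d')"
    by (rule sum_nonneg) (simp add: nxt_def Suc.IH)
  ultimately show ?case using weight_pos[of "fst d"] by (auto simp: darts_def)
qed

text \<open>The uniform distribution on darts is stationary for the non-backtracking walk.\<close>

lemma sum_mean_weight: "(\<Sum>d\<in>darts. mean_weight n d) = 2 * real (Suc n) * (\<Sum>e\<in>E. w e)"
proof (induction n)
  case 0
  show ?case by (simp add: sum_darts)
next
  case (Suc n)
  have "(\<Sum>d\<in>darts. (\<Sum>d'\<in>nxt d. mean_weight n d') / card (nxt d))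
      = (\<Sum>d\<in>darts. \<Sum>d'\<in>nxt d. mean_weight n d' / (mdeg s t E (src d') - 1))"
  proof (intro sum.cong refl)
    fix d assume d: "d \<in> darts"
    have "src d' = tgt d" if "d' \<in> nxt d" for d' using that by (simp add: nxt_def nb_step_def)
    then show "(\<Sum>d'\<in>nxt d. mean_weight n d') / card (nxt d)
        = (\<Sum>d'\<in>nxt d. mean_weight n d' / (mdeg s t E (src d') - 1))"
      by (simp add: sum_divide_distrib card_nxt[OF d])
  qed
  \<comment> \<open>After the exchange of sums, \<open>d'\<close> receives one over (degree of
    \<open>src d'\<close> minus 1) from each of its predecessors, whose number is the same degree
    minus 1; the shares add up to 1.\<close>
  also have "\<dots> = (\<Sum>d'\<in>darts. \<Sum>d | d \<in> darts \<and> nb_step d d'. mean_weight n d' / (mdeg s t E (src d') - 1))"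
    unfolding nxt_def by (rule sum.swap_restrict) auto
  also have "\<dots> = (\<Sum>d'\<in>darts. mean_weight n d')"
  proof (intro sum.cong refl)
    fix d' assume "d' \<in> darts"
    then show "(\<Sum>d | d \<in> darts \<and> nb_step d d'. mean_weight n d' / (mdeg s t E (src d') - 1)) = mean_weight n d'"
      using deg_ge_3[OF src_in_V, of d'] by (simp add: card_prev)
  qed
  finally show ?case
    by (simp add: sum.distrib Suc.IH sum_darts algebra_simps)
qed

lemma card_light_walks_Suc:
  "card (light_walks (Suc n) L d) = (\<Sum>d'\<in>nxt d. card (light_walks n (L - w (fst d)) d'))"
proof -
  have "light_walks (Suc n) L d = (\<Union>d'\<in>nxt d. (#) d ` light_walks n (L - w (fst d)) d')"
    by (auto simp: light_walks_def weight_def algebra_simps)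
  also have "card \<dots> = (\<Sum>d'\<in>nxt d. card ((#) d ` light_walks n (L - w (fst d)) d'))"
  proof (rule card_UN_disjoint)
    show "\<forall>i\<in>nxt d. \<forall>j\<in>nxt d. i \<noteq> j \<longrightarrow>
        (#) d ` light_walks n (L - w (fst d)) i \<inter> (#) d ` light_walks n (L - w (fst d)) j = {}"
    proof (intro ballI impI)
      fix i j assume "i \<in> nxt d" "j \<in> nxt d" "i \<noteq> j"
      then have "light_walks n (L - w (fst d)) i \<inter> light_walks n (L - w (fst d)) j = {}"
        by (intro light_walks_disjoint) (auto simp: nxt_def)
      then show "(#) d ` light_walks n (L - w (fst d)) i \<inter> (#) d ` light_walks n (L - w (fst d)) j = {}"
        by auto
    qed
  qed auto
  finally show ?thesis by (simp add: card_image)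
qed

text \<open>Each walk with \<open>n\<close> branchings has probability at most \<open>1 / 2 ^ n\<close>.\<close>

lemma mean_weight_ge:
  assumes "d \<in> darts"
  shows "L * (1 - card (light_walks n L d) / 2 ^ n) \<le> mean_weight n d"
  using assms
proof (induction n arbitrary: d L)
  case 0
  then have "0 < w (fst d)" using weight_pos by (auto simp: darts_def)
  moreover have "light_walks 0 L d = (if w (fst d) \<le> L then {[d]} else {})"
    by (auto simp: light_walks_def weight_def)
  ultimately show ?case by auto
next
  case (Suc n)
  define c where "c = real (card (nxt d))"
  define M where "M = L - w (fst d)"
  define N where "N d' = real (card (light_walks n M d'))" for d'
  have c: "2 \<le> c" using card_nxt_ge_2[OF Suc.prems] by (simp add: c_def)
  have w: "0 < w (fst d)" using weight_pos Suc.prems by (auto simp: darts_def)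
  have N: "real (card (light_walks (Suc n) L d)) = (\<Sum>d'\<in>nxt d. N d')"
    by (simp add: card_light_walks_Suc N_def M_def)
  have N0: "0 \<le> (\<Sum>d'\<in>nxt d. N d')" by (rule sum_nonneg) (simp add: N_def)
  \<comment> \<open>The left side is a Markov bound, with the number of light walks over
    \<open>2 ^ n\<close> in place of the probability of being light. The last estimate of the step
    uses \<open>0 \<le> M\<close>; otherwise the first dart alone outweighs \<open>L\<close>, which
    settles the claim.\<close>
  show ?case
  proof (cases "0 \<le> M")
    case False
    have "0 \<le> (\<Sum>d'\<in>nxt d. mean_weight n d') / c"
      by (auto intro!: divide_nonneg_nonneg sum_nonneg simp: nxt_def mean_weight_nonneg c_def)
    moreover have "L * (1 - card (light_walks (Suc n) L d) / 2 ^ Suc n) \<le> w (fst d)"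
    proof (cases "0 \<le> L")
      case True
      then have "L * (1 - card (light_walks (Suc n) L d) / 2 ^ Suc n) \<le> L * 1"
        by (intro mult_left_mono) auto
      then show ?thesis using False by (simp add: M_def)
    next
      case F: False
      have "light_walks (Suc n) L d = {}"
      proof -
        have "0 \<le> weight p" if "p \<in> walks (Suc n) d" for p
          using walksD[OF Suc.prems that] weight_pos unfolding weight_def
          by (intro sum_list_nonneg) (force simp: darts_def less_imp_le)
        then show ?thesis using F by (force simp: light_walks_def simp del: walks.simps)
      qed
      then show ?thesis using F w by simp
    qed
    ultimately show ?thesis by (simp add: c_def)
  next
    case True
    have "M * (c - (\<Sum>d'\<in>nxt d. N d') / 2 ^ n) = (\<Sum>d'\<in>nxt d. M * (1 - N d' / 2 ^ n))"
      by (simp add: sum_subtractf sum_divide_distrib sum_distrib_left c_def right_diff_distrib)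
    also have "\<dots> \<le> (\<Sum>d'\<in>nxt d. mean_weight n d')"
      unfolding N_def by (rule sum_mono) (simp add: Suc.IH nxt_def)
    finally have "M * (c - (\<Sum>d'\<in>nxt d. N d') / 2 ^ n) / c \<le> (\<Sum>d'\<in>nxt d. mean_weight n d') / c"
      using c by (intro divide_right_mono) auto
    moreover have "M * (c - (\<Sum>d'\<in>nxt d. N d') / 2 ^ n) / c = M - M * ((\<Sum>d'\<in>nxt d. N d') / (c * 2 ^ n))"
      using c by (simp add: field_simps)
    \<comment> \<open>Here \<open>2 \<le> c\<close> supplies the further factor 2 in the
      denominator, and \<open>0 \<le> M\<close> with \<open>M \<le> L\<close> restores the original
      budget.\<close>
    moreover have "M * ((\<Sum>d'\<in>nxt d. N d') / (c * 2 ^ n)) \<le> L * ((\<Sum>d'\<in>nxt d. N d') / (2 * 2 ^ n))"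
      using c N0 True w by (intro mult_mono divide_left_mono) (auto simp: M_def)
    ultimately show ?thesis
      unfolding N by (simp add: c_def M_def right_diff_distrib)
  qed
qed

text \<open>Otherwise walks of weight at most \<open>L\<close> from one vertex have distinct ends,
  so at most \<open>card V\<close> of them start there. By the choice of \<open>n\<close> they carry
  less than half of the probability, so the mean weight of walks from each vertex exceeds
  \<open>L / 2\<close>. The average over all darts, however, equals \<open>L / 2\<close>.\<close>

lemma light_even_subgraph:
  assumes n: "2 * card V < 3 * 2 ^ n"
  shows "\<exists>F. F \<noteq> {} \<and> F \<subseteq> E \<and> even_subgraph s t F \<and>
    (\<Sum>e\<in>F. w e) * card E \<le> 4 * real (Suc n) * (\<Sum>e\<in>E. w e)"
proof (rule ccontr)
  assume contra: "\<not> ?thesis"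
  define m where "m = real (card E)"
  have m: "0 < m" using E_nonempty finite_E by (simp add: m_def card_gt_0_iff)
  have W: "0 < (\<Sum>e\<in>E. w e)" using E_nonempty finite_E weight_pos by (intro sum_pos) auto
  \<comment> \<open>Twice the average weight of a walk, by \<open>sum_mean_weight\<close>. An even
    subgraph inside two light walks weighs at most \<open>2 * L\<close>, which is the bound
    claimed.\<close>
  define L where "L = 2 * real (Suc n) * (\<Sum>e\<in>E. w e) / m"
  have L: "0 < L" using W m by (simp add: L_def)
  have heavy: "2 * L < (\<Sum>e\<in>F. w e)" if "F \<noteq> {}" "F \<subseteq> E" "even_subgraph s t F" for F
  proof -
    have "4 * real (Suc n) * (\<Sum>e\<in>E. w e) < (\<Sum>e\<in>F. w e) * m"
      using contra that by (auto simp: m_def not_le)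
    then show ?thesis using m by (simp add: L_def field_simps)
  qed
  have sum_le_weight: "(\<Sum>e\<in>fst ` set p. w e) \<le> weight p" if "set p \<subseteq> darts" for p
    using that
  proof (induction p)
    case (Cons d p)
    then have "0 < w (fst d)" using weight_pos by (auto simp: darts_def)
    with Cons show ?case by (auto simp: weight_def sum.insert_if)
  qed (simp add: weight_def)
  have ends_inj: "inj_on (\<lambda>p. tgt (last p)) (\<Union>d\<in>out v. light_walks n L d)" for v
  proof (rule inj_onI, rule ccontr)
    fix p q
    assume p: "p \<in> (\<Union>d\<in>out v. light_walks n L d)" and q: "q \<in> (\<Union>d\<in>out v. light_walks n L d)"
      and en: "tgt (last p) = tgt (last q)" and neq: "p \<noteq> q"
    obtain d d' where d: "d \<in> out v" "p \<in> walks n d" "weight p \<le> L"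
        and d': "d' \<in> out v" "q \<in> walks n d'" "weight q \<le> L"
      using p q by (auto simp: light_walks_def)
    have dd: "d \<in> darts" "d' \<in> darts" "src d = src d'" using d(1) d'(1) by (auto simp: out_def)
    note P = walksD[OF dd(1) d(2)] and Q = walksD[OF dd(2) d'(2)]
    obtain F where F: "F \<noteq> {}" "F \<subseteq> fst ` (set p \<union> set q)" "even_subgraph s t F"
      using even_subgraph_of_two_walks[of p q] P Q en neq dd(3) by auto
    have sub: "fst ` (set p \<union> set q) \<subseteq> E" using P Q by (auto simp: darts_def)
    have "(\<Sum>e\<in>F. w e) \<le> (\<Sum>e\<in>fst ` set p \<union> fst ` set q. w e)"
      using F(2) sub weight_pos by (intro sum_mono2) (auto simp: image_Un less_imp_le subset_iff)
    also have "\<dots> \<le> (\<Sum>e\<in>fst ` set p. w e) + (\<Sum>e\<in>fst ` set q. w e)"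
    proof -
      have "0 \<le> (\<Sum>e\<in>fst ` set p \<inter> fst ` set q. w e)"
        using sub weight_pos by (intro sum_nonneg) (auto simp: less_imp_le subset_iff)
      then show ?thesis by (simp add: sum_Un)
    qed
    also have "\<dots> \<le> 2 * L"
      using sum_le_weight[of p] sum_le_weight[of q] P Q d(3) d'(3) by simp
    finally have "(\<Sum>e\<in>F. w e) \<le> 2 * L" .
    moreover have "F \<subseteq> E" using F(2) sub by (rule order_trans)
    ultimately show False using heavy[OF F(1) _ F(3)] by simp
  qed
  have few: "(\<Sum>d\<in>out v. card (light_walks n L d)) \<le> card V" for v
  proof -
    have "(\<Sum>d\<in>out v. card (light_walks n L d)) = card (\<Union>d\<in>out v. light_walks n L d)"
    proof (rule card_UN_disjoint[symmetric])
      show "\<forall>i\<in>out v. \<forall>j\<in>out v. i \<noteq> j \<longrightarrow> light_walks n L i \<inter> light_walks n L j = {}"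
        using light_walks_disjoint by (simp add: out_def)
    qed auto
    also have "\<dots> \<le> card V"
    proof (rule card_inj_on_le[OF ends_inj])
      show "(\<lambda>p. tgt (last p)) ` (\<Union>d\<in>out v. light_walks n L d) \<subseteq> V"
      proof clarify
        fix d p assume "d \<in> out v" "p \<in> light_walks n L d"
        then have "p \<noteq> []" "set p \<subseteq> darts" using walksD[of d p n] by (auto simp: out_def light_walks_def)
        then show "tgt (last p) \<in> V" using tgt_in_V last_in_set by blast
      qed
    qed (rule finite_V)
    finally show ?thesis .
  qed
  have vertex: "L / 2 * card (out v) < (\<Sum>d\<in>out v. mean_weight n d)" if v: "v \<in> V" for v
  proof -
    have "real (\<Sum>d\<in>out v. card (light_walks n L d)) \<le> real (card V)"
      using few by (simp only: of_nat_le_iff)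
    moreover have "2 * real (card V) < 3 * 2 ^ n"
    proof -
      have "real (2 * card V) < real (3 * 2 ^ n)" using n by (simp only: of_nat_less_iff)
      then show ?thesis by simp
    qed
    moreover have "(3::real) * 2 ^ n \<le> real (card (out v)) * 2 ^ n"
      using deg_ge_3[OF v] by (simp add: card_out)
    ultimately have "(\<Sum>d\<in>out v. real (card (light_walks n L d))) < real (card (out v)) * 2 ^ n / 2"
      unfolding of_nat_sum by linarith
    then have "card (out v) / 2 < card (out v) - (\<Sum>d\<in>out v. real (card (light_walks n L d))) / 2 ^ n"
      by (simp add: field_simps)
    then have "L * (card (out v) / 2) < L * (card (out v) - (\<Sum>d\<in>out v. real (card (light_walks n L d))) / 2 ^ n)"
      using L by (rule mult_strict_left_mono)
    also have "\<dots> = (\<Sum>d\<in>out v. L * (1 - card (light_walks n L d) / 2 ^ n))"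
      by (simp add: sum_subtractf sum_divide_distrib sum_distrib_left right_diff_distrib)
    also have "\<dots> \<le> (\<Sum>d\<in>out v. mean_weight n d)"
      by (rule sum_mono) (simp add: mean_weight_ge out_def)
    finally show ?thesis by simp
  qed
  have by_vertex: "(\<Sum>v\<in>V. \<Sum>d\<in>out v. f d) = (\<Sum>d\<in>darts. f d)" for f :: "'e \<times> bool \<Rightarrow> real"
    unfolding out_def by (rule sum.group) (auto simp: finite_V src_in_V)
  have "V \<noteq> {}" using E_nonempty ends by auto
  have "L / 2 * (2 * m) = (\<Sum>v\<in>V. L / 2 * card (out v))"
    using by_vertex[of "\<lambda>_. L / 2"] by (simp add: darts_def m_def card_cartesian_product algebra_simps)
  also have "\<dots> < (\<Sum>v\<in>V. \<Sum>d\<in>out v. mean_weight n d)"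
    using finite_V \<open>V \<noteq> {}\<close> vertex by (rule sum_strict_mono)
  also have "\<dots> = 2 * real (Suc n) * (\<Sum>e\<in>E. w e)"
    by (simp only: by_vertex sum_mean_weight)
  also have "\<dots> = L * m" using m by (simp add: L_def)
  finally show False by simp
qed

end

section \<open>Short cycles in weighted multigraphs\<close>

text \<open>For \<open>N\<close> vertices and \<open>m\<close> edges, this turns the factor
  \<open>Suc n / m\<close> of \<open>light_even_subgraph\<close> into \<open>log 2 k / k\<close>.
  The hypothesis on \<open>n\<close> expresses that it is the least admissible depth.\<close>

lemma branching_depth_le:
  fixes n k N m :: nat
  assumes k: "9 \<le> k" and N: "1 \<le> N" and m: "N + k \<le> m + 1" and n: "3 * 2 ^ Suc n \<le> 8 * N"
  shows "real (Suc n) * k \<le> log 2 k * m"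
proof -
  define l where "l = log 2 (real k)"
  \<comment> \<open>The bound \<open>3 \<le> l\<close> lets \<open>3 * (real N - 1)\<close> be
    absorbed into \<open>l * (real N - 1)\<close> at the end.\<close>
  have "3 = log 2 (8 :: real)"
    using log2_of_power_eq[of 8 3] by simp
  also have "\<dots> \<le> l"
    unfolding l_def using k by (intro log_mono) auto
  finally have l: "3 \<le> l" .
  have "l * (real N + k - 1) \<le> l * m"
    using m l by (intro mult_left_mono) auto
  moreover have "real (Suc n) * k \<le> l * (real N + k - 1)"
  proof -
    have "(2::real) ^ Suc n \<le> 8 / 3 * N"
    proof -
      have "real (3 * 2 ^ Suc n) \<le> real (8 * N)" using n by (simp only: of_nat_le_iff)
      then show ?thesis by simp
    qed
    then have "log 2 (2 ^ Suc n) \<le> log 2 (8 / 3 * N)"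
      using N by (intro log_mono) auto
    then have depth: "real (Suc n) \<le> log 2 (8 / 3 * N)"
      by (simp add: log_nat_power del: power_Suc)
    have "l * 0 \<le> l * (real N - 1)" using l N by (intro mult_left_mono) auto
    then have lN: "l * k \<le> l * (real N + k - 1)" by (simp add: algebra_simps)
    \<comment> \<open>Up to \<open>8 * N = 3 * k\<close> the depth is at most \<open>l\<close>.
      Beyond that it grows only with the logarithm of \<open>N / k\<close>, while the right side
      grows linearly in \<open>N\<close>.\<close>
    show ?thesis
    proof (cases "8 * N \<le> 3 * k")
      case True
      then have "log 2 (8 / 3 * N) \<le> l"
        unfolding l_def using N by (intro log_mono) auto
      with depth have "real (Suc n) * k \<le> l * k" by (intro mult_right_mono) auto
      with lN show ?thesis by simp
    next
      case False
      define y where "y = real N / k"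
      have y: "0 < y" "3 / 8 \<le> y" "real N = y * k"
        using False k N by (auto simp: y_def field_simps)
      have "log 2 (8 / 3 * N) = log 2 (k * (4 / 3) * (2 * y))"
        by (simp add: y(3) field_simps)
      also have "\<dots> = log 2 (k * (4 / 3)) + log 2 (2 * y)"
        using k y by (intro log_mult_pos) auto
      also have "log 2 (k * (4 / 3)) = l + log 2 (4 / 3)"
        unfolding l_def using k by (intro log_mult_pos) auto
      also have "log 2 (4 / 3 :: real) \<le> 1 / 2"
      proof -
        have "2 * log 2 (4 / 3 :: real) = log 2 ((4 / 3) ^ 2)" by (simp add: log_nat_power)
        also have "\<dots> \<le> log 2 2" by (intro log_mono) (auto simp: power2_eq_square)
        finally show ?thesis by simp
      qed
      finally have 1: "log 2 (8 / 3 * N) \<le> l + 1 / 2 + log 2 (2 * y)" by simp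
      \<comment> \<open>A linear bound from \<open>ln x \<le> x - 1\<close> and
        \<open>ln 2 \<ge> 2 / 3\<close>; the maximum with 0 covers \<open>2 * y < 1\<close>, where
        the logarithm is negative.\<close>
      have log2: "log 2 (2 * y) \<le> max 0 (3 / 2 * (2 * y - 1))"
      proof (cases "1 \<le> 2 * y")
        case True
        have "ln (2 * y) \<le> 2 * y - 1" using y by (intro ln_le_minus_one) auto
        also have "\<dots> \<le> (2 * y - 1) * (3 / 2 * ln 2)"
          using mult_left_mono[of 1 "3 / 2 * ln (2::real)" "2 * y - 1"] ln2_ge_two_thirds True by simp
        finally have "ln (2 * y) / ln 2 \<le> 3 / 2 * (2 * y - 1)"
          by (subst pos_divide_le_eq) (simp_all add: algebra_simps)
        then show ?thesis unfolding log_def by (rule max.coboundedI2)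
      qed (use y in \<open>simp add: max_def\<close>)
      \<comment> \<open>Multiplied by \<open>k\<close>, the term \<open>3 / k\<close> turns
        \<open>3 * N\<close> into \<open>3 * (N - 1)\<close>. It is at most 1/3, and the two cases
        leave room of at least 5/8.\<close>
      have "real (Suc n) \<le> l + 3 * y - 3 / k"
      proof -
        have "3 / real k \<le> 1 / 3" using k by (simp add: field_simps)
        moreover have "log 2 (2 * y) \<le> 0 \<or> log 2 (2 * y) \<le> 3 / 2 * (2 * y - 1)"
          using log2 by (simp only: le_max_iff_disj)
        ultimately show ?thesis using depth 1 y(2) by (elim disjE) argo+
      qed
      then have "real (Suc n) * k \<le> (l + 3 * y - 3 / k) * k" by (intro mult_right_mono) auto
      also have "\<dots> = l * k + 3 * (real N - 1)" using k y by (simp add: field_simps)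
      also have "\<dots> \<le> l * k + l * (real N - 1)" using l N by (intro add_left_mono mult_right_mono) auto
      finally show ?thesis by (simp add: algebra_simps)
    qed
  qed
  ultimately show ?thesis by (simp add: l_def)
qed

section \<open>Reduction to minimum degree three\<close>

definition isolated_in :: "('e \<Rightarrow> 'v) \<Rightarrow> ('e \<Rightarrow> 'v) \<Rightarrow> 'e set \<Rightarrow> 'v \<Rightarrow> bool" where
  "isolated_in s t F v \<longleftrightarrow> (\<forall>e\<in>F. s e \<noteq> v \<and> t e \<noteq> v)"

lemma mdeg_remove:
  "finite F \<Longrightarrow> e \<in> F \<Longrightarrow>
    mdeg s t F v = of_bool (s e = v) + of_bool (t e = v) + mdeg s t (F - {e}) v"
  unfolding mdeg_def by (simp add: sum.remove)

text \<open>Edges at \<open>v\<close> are split off one at a time. The two edges of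
  \<open>path\<close> may be parallel, and suppressing \<open>v\<close> then creates a loop; hence
  the reduction takes place in multigraphs.\<close>

lemma low_degree_cases:
  assumes "finite E" "mdeg s t E v < 3"
  obtains (isolated) "isolated_in s t E v"
  | (loop) e where "e \<in> E" "s e = v" "t e = v" "isolated_in s t (E - {e}) v"
  | (leaf) e where "e \<in> E" "(s e = v) \<noteq> (t e = v)" "isolated_in s t (E - {e}) v"
  | (path) e f where "e \<in> E" "f \<in> E" "e \<noteq> f" "(s e = v) \<noteq> (t e = v)" "(s f = v) \<noteq> (t f = v)"
      "isolated_in s t (E - {e} - {f}) v"
proof -
  have zero: "isolated_in s t F v" if "finite F" "mdeg s t F v = 0" for F
    using that by (auto simp: mdeg_def isolated_in_def)
  show thesis
  proof (cases "isolated_in s t E v")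
    case False
    then obtain e where e: "e \<in> E" "s e = v \<or> t e = v" by (auto simp: isolated_in_def)
    note deg_e = mdeg_remove[OF assms(1) e(1), of s t v]
    show thesis
    proof (cases "isolated_in s t (E - {e}) v")
      case True
      with e loop[OF e(1)] leaf[OF e(1)] show thesis by blast
    next
      case False
      then obtain f where f: "f \<in> E - {e}" "s f = v \<or> t f = v" by (auto simp: isolated_in_def)
      note deg_f = mdeg_remove[of "E - {e}" f s t v]
      have "(s e = v) \<noteq> (t e = v)" "(s f = v) \<noteq> (t f = v)" "mdeg s t (E - {e} - {f}) v = 0"
        using assms e f deg_e deg_f by (auto simp: of_bool_def split: if_splits)
      moreover from this have "isolated_in s t (E - {e} - {f}) v"
        using assms by (intro zero) auto
      ultimately show thesis using e f path[of e f] by auto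
    qed
  qed (rule isolated)
qed

text \<open>
  The alternative \<open>k \<le> C\<close> is the range where every cycle is short enough.
\<close>

lemma short_even_subgraph:
  fixes w :: "'e \<Rightarrow> real" and C :: real and k :: nat
  assumes "finite V" "finite E" "V \<noteq> {}"
    and "\<And>e. e \<in> E \<Longrightarrow> s e \<in> V \<and> t e \<in> V" and "\<And>e. e \<in> E \<Longrightarrow> 0 < w e"
    and k: "1 \<le> k" and "card V + k \<le> card E + 1"
    and C: "k \<le> C \<or> 9 \<le> k \<and> 4 * log 2 k \<le> C"
  shows "\<exists>F. F \<noteq> {} \<and> F \<subseteq> E \<and> even_subgraph s t F \<and> k * (\<Sum>e\<in>F. w e) \<le> C * (\<Sum>e\<in>E. w e)"
  using assms(1-5,7)
proof (induction "card V" arbitrary: V E s t w rule: less_induct)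
  \<comment> \<open>The inequality between \<open>card V\<close> and \<open>card E\<close> forces
    the Betti number to be at least \<open>k\<close>. Every reduction removes one vertex and at most
    one edge, so the inequality persists. Suppression changes \<open>s\<close>, \<open>t\<close> and
    \<open>w\<close>, which therefore vary in the induction.\<close>
  case less
  note fin = \<open>finite V\<close> \<open>finite E\<close> and ends = less.prems(4) and pos = less.prems(5)
  have C0: "0 \<le> C"
  proof -
    have "0 \<le> log 2 (real k)" using k by simp
    then show ?thesis using C by linarith
  qed
  have shrink: "card (V - {v}) < card V" "card (V - {v}) + 1 = card V" if "v \<in> V" for v
    using that fin card_gt_0_iff[of V] by (auto simp: card_Diff_singleton)
  have cardE: "1 \<le> card E" using less.prems(3,6) fin k card_gt_0_iff[of V] by simp
  have mono: "C * (\<Sum>e\<in>F. w e) \<le> C * (\<Sum>e\<in>E. w e)" if "F \<subseteq> E" for F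
    using that fin pos C0 by (intro mult_left_mono sum_mono2) (auto simp: less_imp_le)
  have any: ?case if F: "F \<noteq> {}" "F \<subseteq> E" "even_subgraph s t F" and "k \<le> C" for F
  proof -
    have "k * (\<Sum>e\<in>F. w e) \<le> C * (\<Sum>e\<in>F. w e)"
      using that pos by (intro mult_right_mono sum_nonneg) (auto simp: less_imp_le)
    also have "\<dots> \<le> C * (\<Sum>e\<in>E. w e)" using mono F by blast
    finally show ?thesis using F by blast
  qed
  have delete: ?case if v: "v \<in> V" and e: "e \<in> E" "isolated_in s t (E - {e}) v" and "V - {v} \<noteq> {}" for v e
  proof -
    have "\<exists>F. F \<noteq> {} \<and> F \<subseteq> E - {e} \<and> even_subgraph s t F \<and>
        k * (\<Sum>e\<in>F. w e) \<le> C * (\<Sum>e\<in>E - {e}. w e)"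
    proof (rule less.hyps)
      show "card (V - {v}) + k \<le> card (E - {e}) + 1"
        using less.prems(6) shrink(2)[OF v] e cardE by simp
    qed (use that fin ends pos shrink in \<open>auto simp: isolated_in_def\<close>)
    then show ?thesis using mono[of "E - {e}"] by (meson Diff_subset order_trans)
  qed
  show ?case
  proof (cases "\<exists>v\<in>V. mdeg s t E v < 3")
    case False
    interpret min_degree_3_multigraph s t V E w
      using fin ends pos cardE False by unfold_locales (auto simp: not_less)
    \<comment> \<open>The smallest depth that \<open>light_even_subgraph\<close> admits. Its
      minimality gives the upper bound on \<open>2 ^ Suc n\<close> that
      \<open>branching_depth_le\<close> asks for; at depth 0 that bound follows from
      \<open>1 \<le> card V\<close>.\<close>
    define n where "n = (LEAST n. 2 * card V < 3 * 2 ^ n)"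
    have "2 * card V < 3 * 2 ^ (2 * card V)"
      using less_exp[of "2 * card V"] by linarith
    then have n: "2 * card V < 3 * 2 ^ n" unfolding n_def by (rule LeastI)
    have N: "1 \<le> card V" using less.prems(3) fin by (simp add: Suc_le_eq card_gt_0_iff)
    have least: "3 * 2 ^ Suc n \<le> 8 * card V"
    proof (cases n)
      case (Suc n')
      then have "n' < n" by simp
      then have "\<not> 2 * card V < 3 * 2 ^ n'" unfolding n_def by (rule not_less_Least)
      then show ?thesis using Suc by simp
    qed (use N in auto)
    obtain F where F: "F \<noteq> {}" "F \<subseteq> E" "even_subgraph s t F"
      and light: "(\<Sum>e\<in>F. w e) * card E \<le> 4 * real (Suc n) * (\<Sum>e\<in>E. w e)"
      using light_even_subgraph[OF n] by blast
    have W: "0 \<le> (\<Sum>e\<in>E. w e)" using pos by (intro sum_nonneg) (auto simp: less_imp_le)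
    show ?thesis
    proof (cases "k \<le> C")
      case True
      with F any show ?thesis by blast
    next
      case False
      then have k9: "9 \<le> k" and Ck: "4 * log 2 k \<le> C" using C by auto
      have "4 * real (Suc n) * k \<le> 4 * log 2 k * card E"
        using mult_left_mono[OF branching_depth_le[OF k9 N less.prems(6) least], of 4]
        by (simp only: mult.assoc)
      also have "\<dots> \<le> C * card E" using Ck by (intro mult_right_mono) auto
      finally have "4 * real (Suc n) * k * (\<Sum>e\<in>E. w e) \<le> C * card E * (\<Sum>e\<in>E. w e)"
        using W by (rule mult_right_mono)
      moreover have "k * ((\<Sum>e\<in>F. w e) * card E) \<le> k * (4 * real (Suc n) * (\<Sum>e\<in>E. w e))"
        using light by (rule mult_left_mono) simp
      ultimately have "(k * (\<Sum>e\<in>F. w e)) * card E \<le> (C * (\<Sum>e\<in>E. w e)) * card E"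
        by (simp add: mult_ac)
      then show ?thesis using F cardE by auto
    qed
  next
    case True
    then obtain v where v: "v \<in> V" "mdeg s t E v < 3" by blast
    from fin(2) v(2) show ?thesis
    proof (cases rule: low_degree_cases)
      case isolated
      show ?thesis
      proof (rule less.hyps)
        obtain e where "e \<in> E" using cardE by fastforce
        then show "V - {v} \<noteq> {}" using ends isolated by (force simp: isolated_in_def)
        show "card (V - {v}) + k \<le> card E + 1" using less.prems(6) shrink(2)[OF v(1)] by simp
      qed (use v isolated fin ends pos shrink in \<open>auto simp: isolated_in_def\<close>)
    next
      case (leaf e)
      then have "V - {v} \<noteq> {}" using ends[of e] by auto
      with leaf v(1) show ?thesis by (intro delete)
    next
      case (loop e)
      \<comment> \<open>The loop is itself an even subgraph, but it may be too heavy if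
        \<open>C < k\<close>. Then it is deleted together with \<open>v\<close>, and
        \<open>9 \<le> k\<close> guarantees another edge and so another vertex.\<close>
      show ?thesis
      proof (cases "k \<le> C")
        case True
        have "even_subgraph s t {e}"
          using loop by (auto simp: even_subgraph_def mdeg_def)
        with True loop show ?thesis by (intro any[of "{e}"]) auto
      next
        case False
        then have "9 \<le> k" using C by auto
        then have "card (E - {e}) \<noteq> 0"
          using less.prems(6) loop(1) fin shrink[OF v(1)] by simp
        then have "E - {e} \<noteq> {}" by (metis card.empty)
        then obtain f where "f \<in> E - {e}" by blast
        then have "V - {v} \<noteq> {}" using ends[of f] loop by (auto simp: isolated_in_def)
        with loop v(1) show ?thesis by (intro delete)
      qed
    next
      case (path e f)
      \<comment> \<open>Suppress \<open>v\<close>: the edge \<open>e\<close> takes over \<open>f\<close> and its weight.\<close>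
      define x where "x = (if s e = v then t e else s e)"
      define y where "y = (if s f = v then t f else s f)"
      define s' t' w' where "s' = s(e := x)" and "t' = t(e := y)" and "w' = w(e := w e + w f)"
      have xy: "x \<in> V - {v}" "y \<in> V - {v}"
        using path ends[of e] ends[of f] by (auto simp: x_def y_def)
      have "\<exists>F. F \<noteq> {} \<and> F \<subseteq> E - {f} \<and> even_subgraph s' t' F \<and>
        k * (\<Sum>e\<in>F. w' e) \<le> C * (\<Sum>e\<in>E - {f}. w' e)"
      proof (rule less.hyps)
        show "card (V - {v}) + k \<le> card (E - {f}) + 1"
          using less.prems(6) shrink(2)[OF v(1)] path cardE by simp
        show "s' g \<in> V - {v} \<and> t' g \<in> V - {v}" if "g \<in> E - {f}" for g
          using xy that path(6) ends[of g] by (auto simp: s'_def t'_def isolated_in_def)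
        show "0 < w' g" if "g \<in> E - {f}" for g
          using pos[of e] pos[of f] pos[of g] that path by (auto simp: w'_def)
      qed (use v xy fin shrink in auto)
      then obtain F where F: "F \<noteq> {}" "F \<subseteq> E - {f}" "even_subgraph s' t' F"
        and light: "k * (\<Sum>e\<in>F. w' e) \<le> C * (\<Sum>e\<in>E - {f}. w' e)" by blast
      have finF: "finite F" using F(2) fin(2) finite_subset by blast
      have sum_w': "(\<Sum>g\<in>G. w' g) = (\<Sum>g\<in>insert f G. w g)" if "finite G" "e \<in> G" "f \<notin> G" for G
      proof -
        have "(\<Sum>g\<in>G - {e}. w' g) = (\<Sum>g\<in>G - {e}. w g)" by (rule sum.cong) (auto simp: w'_def)
        then show ?thesis using that by (simp add: sum.remove w'_def)
      qed
      have W: "(\<Sum>e\<in>E - {f}. w' e) = (\<Sum>e\<in>E. w e)"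
        using sum_w'[of "E - {f}"] path fin by (simp add: insert_absorb)
      have away: "mdeg s' t' G u = mdeg s t G u" if "e \<notin> G" for G u
        unfolding mdeg_def using that by (intro sum.cong) (auto simp: s'_def t'_def)
      show ?thesis
      proof (cases "e \<in> F")
        case False
        then have "(\<Sum>e\<in>F. w' e) = (\<Sum>e\<in>F. w e)" by (intro sum.cong) (auto simp: w'_def)
        then show ?thesis using F light W away[OF False] by (auto simp: even_subgraph_def)
      next
        case True
        \<comment> \<open>Putting \<open>v\<close> back into the merged edge adds 2 to the degree at
          \<open>v\<close> and changes no other degree, so parity is kept.\<close>
        have "mdeg s t (insert f F) u = mdeg s' t' F u + 2 * of_bool (u = v)" for u
        proof -
          have "mdeg s t (insert f F) u = of_bool (s f = u) + of_bool (t f = u) + mdeg s t F u"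
            using F(2) finF unfolding mdeg_def by (subst sum.insert) auto
          also have "mdeg s t F u = of_bool (s e = u) + of_bool (t e = u) + mdeg s t (F - {e}) u"
            using finF True by (rule mdeg_remove)
          also have "mdeg s t (F - {e}) u = mdeg s' t' (F - {e}) u" by (simp add: away)
          finally show ?thesis
            using mdeg_remove[OF finF True, of s' t' u] path(4,5)
            by (auto simp: s'_def t'_def x_def y_def)
        qed
        then have "even_subgraph s t (insert f F)"
          using F(3) by (auto simp: even_subgraph_def)
        moreover have "(\<Sum>e\<in>F. w' e) = (\<Sum>e\<in>insert f F. w e)"
          using F(2) True finF by (intro sum_w') auto
        ultimately show ?thesis using F path light W by (intro exI[of _ "insert f F"]) auto
      qed
    qed
  qed
qed

section \<open>Cycles and homology of simplicial graphs\<close>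

text \<open>Take a longest path in \<open>F\<close>. Its first vertex \<open>x\<close> has a second
  edge in \<open>F\<close>, whose other end \<open>u\<close> lies on the path by maximality. As
  \<open>u\<close> is neither \<open>x\<close> nor its successor \<open>y\<close>, the initial
  segment up to \<open>u\<close> closes to a cycle with at least three vertices.\<close>

lemma cycle_in_min_degree_2:
  assumes "simplicial_complex K" and F: "F \<subseteq> simplices K 1" "F \<noteq> {}"
    and deg: "\<And>e v. e \<in> F \<Longrightarrow> v \<in> e \<Longrightarrow> \<exists>f\<in>F. f \<noteq> e \<and> v \<in> f"
  shows "\<exists>\<gamma>. cycle_in K \<gamma> \<and> simplices \<gamma> 1 \<subseteq> F"
proof -
  have K: "finite K" "\<And>\<sigma> \<tau>. \<sigma> \<in> K \<Longrightarrow> \<tau> \<noteq> {} \<Longrightarrow> \<tau> \<subseteq> \<sigma> \<Longrightarrow> \<tau> \<in> K"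
    using assms(1) unfolding simplicial_complex_def by blast+
  have FK: "F \<subseteq> K" and card2: "\<And>e. e \<in> F \<Longrightarrow> card e = 2"
    using F(1) by (auto simp: simplices_def)
  define path where "path vs \<longleftrightarrow> 2 \<le> length vs \<and> distinct vs \<and> successively (\<lambda>x y. {x, y} \<in> F) vs" for vs
  obtain e where "e \<in> F" using F(2) by blast
  then obtain a b where "e = {a, b}" "a \<noteq> b" using card2 by (meson card_2_iff)
  with \<open>e \<in> F\<close> have start: "path [a, b]" by (simp add: path_def)
  have fin: "finite (\<Union>F)"
    using card2 finite_subset[OF FK K(1)] by (intro finite_Union) (auto intro: card_ge_0_finite)
  have bound: "length vs < Suc (card (\<Union>F))" if "path vs" for vs
  proof -
    have "set vs \<subseteq> \<Union>F"
    proof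
      fix v assume "v \<in> set vs"
      then obtain xs ys where vs: "vs = xs @ v # ys" using split_list by metis
      show "v \<in> \<Union>F"
      proof (cases ys)
        case Nil
        then have "xs \<noteq> []" using that vs by (auto simp: path_def)
        then have "{last xs, v} \<in> F" using that vs by (auto simp: path_def successively_append_iff)
        then show ?thesis by blast
      next
        case (Cons y zs)
        then have "{v, y} \<in> F" using that vs by (auto simp: path_def successively_append_iff)
        then show ?thesis by blast
      qed
    qed
    then have "card (set vs) \<le> card (\<Union>F)" using fin by (rule card_mono[rotated])
    then show ?thesis using that by (simp add: path_def distinct_card)
  qed
  obtain vs where vs: "path vs" "\<And>us. path us \<Longrightarrow> length us \<le> length vs"
    using ex_has_greatest_nat[of path "[a, b]" length "Suc (card (\<Union>F))"] start bound by auto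
  obtain x y zs where vs_eq: "vs = x # y # zs"
    using vs(1) by (cases vs; cases "tl vs") (auto simp: path_def)
  have xy: "{x, y} \<in> F" using vs(1) by (simp add: path_def vs_eq)
  obtain f where f: "f \<in> F" "f \<noteq> {x, y}" "x \<in> f" using deg[OF xy, of x] by auto
  obtain u where u: "f = {u, x}" "u \<noteq> x"
    using card2[OF f(1)] f(3) unfolding card_2_iff by (metis insert_commute insertE singletonD)
  have "u \<in> set zs"
  proof (rule ccontr)
    assume "u \<notin> set zs"
    then have "path (u # vs)" using vs(1) u f by (auto simp: path_def vs_eq insert_commute)
    then show False using vs(2) by fastforce
  qed
  then obtain as bs where zs: "zs = as @ u # bs" using split_list by metis
  define ws where "ws = x # y # as @ [u]"
  have vs_ws: "vs = ws @ bs" by (simp add: vs_eq zs ws_def)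
  then have ws: "distinct ws" "successively (\<lambda>x y. {x, y} \<in> F) ws"
    using vs(1) by (auto simp: path_def successively_append_iff)
  have len_ws: "3 \<le> length ws" by (simp add: ws_def)
  have edge: "{ws ! i, ws ! (Suc i mod length ws)} \<in> F" if "i < length ws" for i
  proof (cases "Suc i < length ws")
    case True
    then show ?thesis using ws(2) by (simp add: successively_conv_nth)
  next
    case False
    then have "Suc i = length ws" using that by simp
    moreover from this have "ws ! i = u" by (simp add: ws_def nth_append)
    moreover have "ws ! 0 = x" by (simp add: ws_def)
    ultimately show ?thesis using f(1) u(1) by simp
  qed
  have "closed_path_complex ws \<subseteq> K"
  proof -
    have "{ws ! i} \<in> K" if "i < length ws" for i
      using edge[OF that] FK K(2)[of _ "{ws ! i}"] by blast
    then show ?thesis using edge FK by (fastforce simp: closed_path_complex_def set_conv_nth)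
  qed
  then have "cycle_in K (closed_path_complex ws)" using ws len_ws by (auto simp: cycle_in_def)
  moreover have "simplices (closed_path_complex ws) 1 \<subseteq> F"
    using edge by (auto simp: simplices_def closed_path_complex_def)
  ultimately show ?thesis by blast
qed

text \<open>Indices with the same edge are equal or cyclic successors of each other, and distinct
  indices of the latter kind occur only in length 2.\<close>

lemma cyclic_edges_inj:
  assumes "distinct vs" "3 \<le> length vs"
  shows "inj_on (\<lambda>i. {vs ! i, vs ! (Suc i mod length vs)}) {..<length vs}"
proof (rule inj_onI)
  fix i j assume ij: "i \<in> {..<length vs}" "j \<in> {..<length vs}"
    and eq: "{vs ! i, vs ! (Suc i mod length vs)} = {vs ! j, vs ! (Suc j mod length vs)}"
  have lt: "Suc i mod length vs < length vs" "Suc j mod length vs < length vs"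
    using assms(2) by (intro mod_less_divisor; linarith)+
  from eq have "i = j \<or> i = Suc j mod length vs \<and> Suc i mod length vs = j"
    using ij lt assms(1) by (auto simp: doubleton_eq_iff nth_eq_iff_index_eq)
  then show "i = j" using ij assms(2) by (auto simp: mod_Suc split: if_splits)
qed

lemma simplices_closed_path:
  assumes "distinct vs" "3 \<le> length vs"
  shows "simplices (closed_path_complex vs) 1
    = (\<lambda>i. {vs ! i, vs ! (Suc i mod length vs)}) ` {..<length vs}"
proof -
  have "vs ! i \<noteq> vs ! (Suc i mod length vs)" if "i < length vs" for i
  proof -
    have "Suc i mod length vs < length vs" using assms(2) by (intro mod_less_divisor) linarith
    moreover have "Suc i mod length vs \<noteq> i" using that assms(2) by (auto simp: mod_Suc)
    ultimately show ?thesis using that assms(1) by (simp add: nth_eq_iff_index_eq)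
  qed
  then show ?thesis by (auto simp: simplices_def closed_path_complex_def)
qed

text \<open>Each edge contributes its two ends to the boundary. Rotation of the indices identifies
  the sum over first ends with the sum over second ends, and the two cancel in characteristic
  2.\<close>

lemma fundamental_class_in_H1:
  assumes "simplicial_complex K" "cycle_in K \<gamma>"
  shows "fundamental_class \<gamma> \<in> H1 K"
proof -
  obtain vs where vs: "3 \<le> length vs" "distinct vs" "\<gamma> = closed_path_complex vs" "\<gamma> \<subseteq> K"
    using assms(2) by (auto simp: cycle_in_def)
  define n where "n = length vs"
  define g where "g = (\<lambda>i. {vs ! i, vs ! (Suc i mod n)})"
  have g: "simplices \<gamma> 1 = g ` {..<n}" "inj_on g {..<n}"
    using simplices_closed_path[OF vs(2,1)] cyclic_edges_inj[OF vs(2,1)]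
    by (simp_all add: vs(3) g_def n_def)
  have sub: "simplices \<gamma> 1 \<subseteq> simplices K 1" using vs(4) by (auto simp: simplices_def)
  have fin: "finite (simplices K 1)" using assms(1) by (simp add: simplices_def simplicial_complex_def)
  have bij: "bij_betw (\<lambda>i. Suc i mod n) {..<n} {..<n}"
  proof -
    have "inj_on (\<lambda>i. Suc i mod n) {..<n}"
      by (rule inj_onI) (auto simp: mod_Suc split: if_splits)
    moreover have "(\<lambda>i. Suc i mod n) ` {..<n} \<subseteq> {..<n}" by auto
    ultimately show ?thesis by (simp add: bij_betw_def endo_inj_surj)
  qed
  have "(\<Sum>\<sigma> | \<sigma> \<in> simplices K 1 \<and> {v} \<subseteq> \<sigma>. fundamental_class \<gamma> \<sigma>) = 0" for v
  proof -
    have "(\<Sum>\<sigma> | \<sigma> \<in> simplices K 1 \<and> {v} \<subseteq> \<sigma>. fundamental_class \<gamma> \<sigma>)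
        = (\<Sum>\<sigma>\<in>simplices \<gamma> 1. of_bool (v \<in> \<sigma>))"
      using fin sub
      by (intro sum.mono_neutral_cong) (auto simp: fundamental_class_def intro: finite_subset)
    also have "\<dots> = (\<Sum>i<n. of_bool (v \<in> g i))"
      unfolding g(1) by (simp add: sum.reindex[OF g(2)])
    also have "\<dots> = (\<Sum>i<n. of_bool (v = vs ! i) + of_bool (v = vs ! (Suc i mod n)))"
    proof (intro sum.cong refl)
      fix i assume "i \<in> {..<n}"
      then have "g i \<in> simplices \<gamma> 1" using g(1) by blast
      then have "card (g i) = 2" by (simp add: simplices_def)
      then have "vs ! i \<noteq> vs ! (Suc i mod n)" by (auto simp: g_def)
      then show "(of_bool (v \<in> g i) :: bit) = of_bool (v = vs ! i) + of_bool (v = vs ! (Suc i mod n))"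
        by (auto simp: g_def)
    qed
    also have "\<dots> = (\<Sum>i<n. of_bool (v = vs ! i)) + (\<Sum>i<n. of_bool (v = vs ! (Suc i mod n)))"
      by (rule sum.distrib)
    also have "(\<Sum>i<n. of_bool (v = vs ! (Suc i mod n))) = (\<Sum>i<n. of_bool (v = vs ! i) :: bit)"
      by (rule sum.reindex_bij_betw[OF bij, of "\<lambda>i. of_bool (v = vs ! i)"])
    finally show ?thesis by simp
  qed
  then have "boundary K 0 (fundamental_class \<gamma>) = 0"
    by (auto simp: boundary_def fun_eq_iff simplices_def card_Suc_eq)
  moreover have "fundamental_class \<gamma> \<in> chains K 1"
    using sub by (auto simp: chains_def fundamental_class_def)
  ultimately show ?thesis by (simp add: H1_def)
qed

text \<open>Oriented arbitrarily and with weight 1, the edges in \<open>E\<close> form a multigraph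
  on all vertices of \<open>K\<close>. A short even subgraph has no vertex of degree one and so
  contains a cycle. Since the vertex set stays fixed, deleting an edge lowers the admissible
  \<open>k\<close> by exactly one.\<close>

lemma short_cycle:
  fixes k :: nat and C :: real
  assumes K: "simplicial_complex K" and V: "\<Union>K \<noteq> {}" and E: "E \<subseteq> simplices K 1"
    and k: "1 \<le> k" and card: "card (\<Union>K) + k \<le> card E + 1"
    and C: "k \<le> C \<or> 9 \<le> k \<and> 4 * log 2 k \<le> C"
  shows "\<exists>\<gamma>. cycle_in K \<gamma> \<and> simplices \<gamma> 1 \<subseteq> E \<and> k * len \<gamma> \<le> C * card E"
proof -
  have fin: "finite K" "finite (\<Union>K)" using K by (auto simp: simplicial_complex_def)
  have finE: "finite E" using finite_subset[OF E] fin by (simp add: simplices_def)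
  have "card e = 2" if "e \<in> E" for e using that E by (auto simp: simplices_def)
  then have "\<forall>e\<in>E. \<exists>a b. e = {a, b} \<and> a \<noteq> b" by (meson card_2_iff)
  then obtain s t where st: "\<And>e. e \<in> E \<Longrightarrow> e = {s e, t e} \<and> s e \<noteq> t e" by metis
  have ends: "s e \<in> \<Union>K \<and> t e \<in> \<Union>K" if "e \<in> E" for e
  proof -
    have "e \<in> K" using that E by (auto simp: simplices_def)
    then show ?thesis using st[OF that] by blast
  qed
  obtain F where F: "F \<noteq> {}" "F \<subseteq> E" "even_subgraph s t F"
    and short: "k * (\<Sum>e\<in>F. 1) \<le> C * (\<Sum>e\<in>E. 1 :: real)"
    using short_even_subgraph[where s = s and t = t and w = "\<lambda>_. 1", OF fin(2) finE V ends _ k card C] by auto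
  have finF: "finite F" using F(2) finE by (rule finite_subset)
  have "\<exists>f\<in>F. f \<noteq> e \<and> v \<in> f" if "e \<in> F" "v \<in> e" for e v
  proof (rule ccontr)
    assume none: "\<not> (\<exists>f\<in>F. f \<noteq> e \<and> v \<in> f)"
    have inc: "of_bool (s f = v) + of_bool (t f = v) = (of_bool (v \<in> f) :: nat)" if "f \<in> F" for f
    proof -
      have f: "f = {s f, t f}" "s f \<noteq> t f" using st that F(2) by blast+
      have "v \<in> f \<longleftrightarrow> s f = v \<or> t f = v" by (subst f(1)) auto
      then show ?thesis using f(2) by auto
    qed
    have "mdeg s t F v = (\<Sum>f\<in>F. of_bool (v \<in> f))"
      unfolding mdeg_def by (intro sum.cong refl inc)
    also have "\<dots> = of_bool (v \<in> e) + (\<Sum>f\<in>F - {e}. of_bool (v \<in> f))"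
      using finF that(1) by (rule sum.remove)
    also have "(\<Sum>f\<in>F - {e}. of_bool (v \<in> f)) = (0 :: nat)"
      using none by (intro sum.neutral) auto
    finally show False using F(3) that(2) unfolding even_subgraph_def by (metis add_0_right odd_one of_bool_eq(2))
  qed
  then obtain \<gamma> where \<gamma>: "cycle_in K \<gamma>" "simplices \<gamma> 1 \<subseteq> F"
    using cycle_in_min_degree_2[OF K order_trans[OF F(2) E] F(1)] by blast
  have "len \<gamma> \<le> card F" unfolding len_def using finF \<gamma>(2) by (rule card_mono)
  then have "k * len \<gamma> \<le> k * card F" by simp
  then have "real (k * len \<gamma>) \<le> real (k * card F)" by (simp only: of_nat_le_iff)
  then show ?thesis using \<gamma> F(2) short by (intro exI[of _ \<gamma>]) auto
qed

text \<open>The single term \<open>n ^ n / fact n\<close> of the exponential series at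
  \<open>n\<close> is at most \<open>exp n\<close>.\<close>

lemma fact_ge_power: "(real n / exp 1) ^ n \<le> fact n"
proof -
  have "real n ^ n /\<^sub>R fact n \<le> exp (real n)"
    using sum_le_suminf[OF summable_exp_generic[of "real n"], of "{n}"]
    by (simp add: exp_def)
  moreover have "exp (real n) = exp 1 ^ n"
    using exp_of_nat_mult[of n "1::real"] by simp
  ultimately show ?thesis
    by (simp add: power_divide divide_simps mult.commute)
qed

section \<open>The Betti number and spanning trees\<close>

lemma sum_apply: "(\<Sum>i\<in>A. f i) x = (\<Sum>i\<in>A. f i x)"
  by (induction A rule: infinite_finite_induct) auto

lemma subspace_H1: "Z2.subspace (H1 K)"
proof (rule Z2.subspaceI)
  show zero: "0 \<in> H1 K" by (auto simp: H1_def chains_def boundary_def fun_eq_iff)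
  show "x + y \<in> H1 K" if "x \<in> H1 K" "y \<in> H1 K" for x y
  proof -
    have "boundary K 0 (x + y) = boundary K 0 x + boundary K 0 y"
      by (simp only: boundary_def fun_eq_iff plus_fun_apply sum.distrib) auto
    then show ?thesis using that by (auto simp: H1_def chains_def)
  qed
  show "(\<lambda>\<sigma>. a * x \<sigma>) \<in> H1 K" if "x \<in> H1 K" for a x
  proof (cases "a = 0")
    case True
    then have "(\<lambda>\<sigma>. a * x \<sigma>) = 0" by (simp add: fun_eq_iff)
    then show ?thesis using zero by (simp only:)
  next
    case False
    then have "(\<lambda>\<sigma>. a * x \<sigma>) = x" by (simp add: fun_eq_iff)
    then show ?thesis using that by (simp only:)
  qed
qed

text \<open>Restriction to the edges off a spanning tree is injective on \<open>H1 K\<close>, and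
  the tree has one edge fewer than there are vertices. Finiteness of independent sets is recorded
  for the exchange argument in \<open>theorem1p7\<close>.\<close>

lemma
  assumes conn: "connected_graph K"
  shows betti1_le: "betti1 K + card (\<Union>K) \<le> card (simplices K 1) + 1"
    and finite_independent_H1: "B \<subseteq> H1 K \<Longrightarrow> Z2.independent B \<Longrightarrow> finite B"
proof -
  have K: "simplicial_complex K" "graph K" using conn by (auto simp: connected_graph_def graph_def)
  define E where "E = simplices K 1"
  define V where "V = \<Union>K"
  have fin: "finite V" "finite E" using K by (auto simp: simplicial_complex_def V_def E_def simplices_def)
  define R where "R = {(x, y). {x, y} \<in> E}"
  have R: "(u, v) \<in> R\<^sup>*" if "u \<in> V" "v \<in> V" for u v
    using conn that unfolding connected_graph_def R_def E_def V_def by blast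
  obtain r where r: "r \<in> V"
    using K(2) unfolding graph_def V_def simplices_def by (force simp: card_Suc_eq)
  define dist where "dist v = (LEAST n. (r, v) \<in> R ^^ n)" for v
  have dist: "(r, v) \<in> R ^^ dist v" if "v \<in> V" for v
    using R[OF r that] unfolding dist_def rtrancl_power by (auto intro: LeastI)
  have dist_le: "dist v \<le> n" if "(r, v) \<in> R ^^ n" for v n
    unfolding dist_def using that by (rule Least_le)
  have "\<exists>u. {u, v} \<in> E \<and> Suc (dist u) = dist v" if v: "v \<in> V - {r}" for v
  proof (cases "dist v")
    case 0
    then show ?thesis using dist[of v] v by simp
  next
    case (Suc n)
    then obtain u where u: "(r, u) \<in> R ^^ n" "(u, v) \<in> R" using dist[of v] v by auto
    have "(r, v) \<in> R ^^ Suc (dist u)"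
    proof -
      have "u \<in> V" using u(2) by (auto simp: R_def E_def V_def simplices_def)
      then show ?thesis using dist u(2) by auto
    qed
    then show ?thesis using dist_le[OF u(1)] dist_le[of v "Suc (dist u)"] Suc u(2)
      by (intro exI[of _ u]) (auto simp: R_def)
  qed
  then obtain p where p: "\<And>v. v \<in> V - {r} \<Longrightarrow> {p v, v} \<in> E \<and> Suc (dist (p v)) = dist v"
    by metis
  \<comment> \<open>The edges from each vertex to its parent form a spanning tree \<open>T\<close>, and a cycle in \<open>T\<close>
    vanishes: look at a farthest vertex whose parent edge carries it.\<close>
  define f where "f v = {p v, v}" for v
  define T where "T = f ` (V - {r})"
  \<comment> \<open>Distinct vertices with the same parent edge would be parents of each other,
    against the drop of \<open>dist\<close>.\<close>
  have f_inj: "inj_on f (V - {r})"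
  proof (rule inj_onI)
    fix u v assume "u \<in> V - {r}" "v \<in> V - {r}" "f u = f v"
    then show "u = v" using p[of u] p[of v] by (auto simp: f_def doubleton_eq_iff)
  qed
  have T: "T \<subseteq> E" "card T + 1 = card V"
    using p r fin card_gt_0_iff[of V] by (auto simp: T_def f_def card_image[OF f_inj, unfolded f_def])
  have tree: "c = 0" if c: "c \<in> H1 K" "\<And>e. e \<in> E - T \<Longrightarrow> c e = 0" for c
  proof (rule ccontr)
    assume "c \<noteq> 0"
    then obtain e where "c e \<noteq> 0" by (auto simp: fun_eq_iff)
    moreover from this have "e \<in> E" using c(1) by (auto simp: H1_def chains_def E_def)
    ultimately have "e \<in> T" using c(2) by blast
    define S where "S = {v \<in> V - {r}. c (f v) \<noteq> 0}"
    have "finite S" "S \<noteq> {}" using \<open>e \<in> T\<close> \<open>c e \<noteq> 0\<close> fin by (auto simp: S_def T_def)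
    then obtain v where v: "v \<in> S" "\<And>u. u \<in> S \<Longrightarrow> dist u \<le> dist v"
      using finite_has_maximal[of "dist ` S"] by (metis (no_types) Max_ge Max_in finite_imageI image_iff image_is_empty)
    have vV: "v \<in> V - {r}" using v(1) by (simp add: S_def)
    \<comment> \<open>Another edge at \<open>v\<close> in the support would be the parent edge of a
      child of \<open>v\<close>, which is farther from \<open>r\<close>.\<close>
    have only: "c \<sigma> = 0" if "\<sigma> \<in> E" "v \<in> \<sigma>" "\<sigma> \<noteq> f v" for \<sigma>
    proof (rule ccontr)
      assume nz: "c \<sigma> \<noteq> 0"
      then have "\<sigma> \<in> T" using that c(2) by blast
      then obtain u where u: "u \<in> V - {r}" "\<sigma> = f u" by (auto simp: T_def)
      then have "u \<in> S" using nz by (simp add: S_def)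
      moreover have "p u = v" using that u by (auto simp: f_def)
      ultimately show False using v(2)[of u] p[OF u(1)] by simp
    qed
    have "{v} \<in> simplices K 0"
    proof -
      have "{p v, v} \<in> K" using p[OF vV] by (simp add: E_def simplices_def)
      then have "{v} \<in> K" using K(1) unfolding simplicial_complex_def by (metis insert_not_empty singletonI subset_insertI)
      then show ?thesis by (simp add: simplices_def)
    qed
    then have "(\<Sum>\<sigma> | \<sigma> \<in> E \<and> {v} \<subseteq> \<sigma>. c \<sigma>) = 0"
      using c(1) by (auto simp: H1_def boundary_def fun_eq_iff E_def split: if_splits)
    moreover have "(\<Sum>\<sigma> | \<sigma> \<in> E \<and> {v} \<subseteq> \<sigma>. c \<sigma>) = (\<Sum>\<sigma>\<in>{f v}. c \<sigma>)"
      using fin only p[OF vV] by (intro sum.mono_neutral_right) (auto simp: f_def)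
    ultimately show False using v(1) by (simp add: S_def)
  qed
  \<comment> \<open>\<open>\<rho>\<close> restricts chains to the edges off the tree, and the
    \<open>\<delta> e\<close> for these edges span its image. By \<open>tree\<close>,
    \<open>\<rho>\<close> is injective on \<open>H1 K\<close>, which bounds the size of independent
    sets.\<close>
  define \<rho> :: "('a set \<Rightarrow> bit) \<Rightarrow> 'a set \<Rightarrow> bit" where "\<rho> c = (\<lambda>\<sigma>. if \<sigma> \<in> E - T then c \<sigma> else 0)" for c
  define \<delta> :: "'a set \<Rightarrow> 'a set \<Rightarrow> bit" where "\<delta> e = (\<lambda>\<sigma>. of_bool (\<sigma> = e))" for e
  interpret P: vector_space_pair "\<lambda>(a::bit) (c::'a set \<Rightarrow> bit) \<sigma>. a * c \<sigma>" "\<lambda>(a::bit) (c::'a set \<Rightarrow> bit) \<sigma>. a * c \<sigma>"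
    by unfold_locales
  have lin: "Vector_Spaces.linear (\<lambda>(a::bit) (c::'a set \<Rightarrow> bit) \<sigma>. a * c \<sigma>) (\<lambda>(a::bit) (c::'a set \<Rightarrow> bit) \<sigma>. a * c \<sigma>) \<rho>"
    unfolding Vector_Spaces.linear_iff
    by (intro conjI allI Z2.vector_space_axioms ext) (simp_all only: \<rho>_def plus_fun_apply, simp_all)
  have main: "finite B \<and> card B + card V \<le> card E + 1" if B: "B \<subseteq> H1 K" "Z2.independent B" for B
  proof -
    have "Z2.span B \<subseteq> H1 K" using B(1) subspace_H1 by (rule Z2.span_minimal)
    have inj: "inj_on \<rho> (Z2.span B)"
    proof (rule inj_onI)
      fix x y assume xy: "x \<in> Z2.span B" "y \<in> Z2.span B" "\<rho> x = \<rho> y"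
      have "x - y \<in> H1 K" using Z2.span_diff[OF xy(1,2)] \<open>Z2.span B \<subseteq> H1 K\<close> by blast
      moreover have "(x - y) e = 0" if "e \<in> E - T" for e
        using fun_cong[OF xy(3), of e] that by (simp add: \<rho>_def)
      ultimately have "x - y = 0" by (rule tree)
      then show "x = y" by simp
    qed
    have "Z2.independent (\<rho> ` B)"
      using P.linear_independent_injective_image[OF lin B(2) inj] .
    moreover have "\<rho> ` B \<subseteq> Z2.span (\<delta> ` (E - T))"
    proof
      fix c' assume "c' \<in> \<rho> ` B"
      then obtain c where c: "c' = \<rho> c" by blast
      have "c' = (\<Sum>e\<in>E - T. (\<lambda>\<sigma>. c e * \<delta> e \<sigma>))"
      proof
        fix \<sigma>
        have "(\<Sum>e\<in>E - T. (\<lambda>\<sigma>. c e * \<delta> e \<sigma>)) \<sigma> = (\<Sum>e\<in>E - T. if e = \<sigma> then c e else 0)"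
          unfolding sum_apply by (intro sum.cong) (auto simp: \<delta>_def)
        then show "c' \<sigma> = (\<Sum>e\<in>E - T. (\<lambda>\<sigma>. c e * \<delta> e \<sigma>)) \<sigma>"
          using fin by (simp add: c \<rho>_def)
      qed
      also have "\<dots> \<in> Z2.span (\<delta> ` (E - T))"
        by (intro Z2.span_sum Z2.span_scale Z2.span_base imageI)
      finally show "c' \<in> Z2.span (\<delta> ` (E - T))" .
    qed
    ultimately have "finite (\<rho> ` B) \<and> card (\<rho> ` B) \<le> card (\<delta> ` (E - T))"
      using fin by (intro Z2.independent_span_bound) auto
    moreover have "card (\<delta> ` (E - T)) \<le> card (E - T)" using fin by (intro card_image_le) auto
    moreover have "inj_on \<rho> B" using inj Z2.span_superset inj_on_subset by blast
    ultimately have "finite B" "card B \<le> card (E - T)"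
      by (auto simp: finite_image_iff card_image)
    moreover have "card (E - T) + card T = card E"
      using T(1) fin card_mono[OF fin(2) T(1)] finite_subset[OF T(1)] by (simp add: card_Diff_subset)
    ultimately show ?thesis using T(2) by simp
  qed
  then show "finite B" if "B \<subseteq> H1 K" "Z2.independent B" using that by blast
  obtain B where B: "B \<subseteq> H1 K" "Z2.independent B" "card B = Z2.dim (H1 K)"
    using Z2.basis_exists[of "H1 K"] by metis
  then show "betti1 K + card (\<Union>K) \<le> card (simplices K 1) + 1"
    using main[OF B(1,2)] by (simp add: betti1_def E_def V_def)
qed

section \<open>The greedy basis\<close>

text \<open>The first cycle chosen gets index \<open>Suc k\<close>; the others are found after one
  of its edges is deleted. The cycle of index \<open>i\<close> has length at most
  \<open>4 * log 2 b * len K / i\<close>, whence the factorial. Fixing \<open>b\<close> while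
  \<open>k\<close> varies allows one constant for all steps.\<close>

lemma greedy_cycles:
  fixes K :: "'a set set" and b k :: nat
  assumes K: "simplicial_complex K" and V: "\<Union>K \<noteq> {}" and b: "2 \<le> b"
    and "E \<subseteq> simplices K 1" "card (\<Union>K) + k \<le> card E + 1" "k \<le> b"
  shows "\<exists>\<gamma> :: nat \<Rightarrow> 'a set set. (\<forall>i\<in>{1..k}. cycle_in K (\<gamma> i) \<and> simplices (\<gamma> i) 1 \<subseteq> E) \<and>
    inj_on (\<lambda>i. fundamental_class (\<gamma> i)) {1..k} \<and>
    Z2.independent ((\<lambda>i. fundamental_class (\<gamma> i)) ` {1..k}) \<and>
    (\<Prod>i=1..k. real (len (\<gamma> i))) \<le> (4 * log 2 b * len K) ^ k / fact k"
  using assms(4-6)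
proof (induction k arbitrary: E)
  case 0
  then show ?case using Z2.independent_empty by simp
next
  case (Suc k)
  have fin: "finite (simplices K 1)" using K by (simp add: simplices_def simplicial_complex_def)
  have finE: "finite E" using Suc.prems(1) fin by (rule finite_subset)
  have log_b: "1 \<le> log 2 (real b)" using b by simp
  \<comment> \<open>The hypothesis of \<open>short_cycle\<close> for \<open>C = 4 * log 2 b\<close>.
    Below 9 every cycle is short enough: \<open>C\<close> is at least 8 if \<open>4 \<le> b\<close>,
    and otherwise \<open>Suc k \<le> 3\<close> and \<open>4 \<le> C\<close>.\<close>
  have "real (Suc k) \<le> 4 * log 2 b \<or> 9 \<le> Suc k \<and> 4 * log 2 (Suc k) \<le> 4 * log 2 b"
  proof (cases "9 \<le> Suc k")
    case True
    then have "log 2 (real (Suc k)) \<le> log 2 (real b)" using Suc.prems(3) b by (intro log_mono) auto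
    with True show ?thesis by simp
  next
    case small: False
    show ?thesis
    proof (cases "4 \<le> b")
      case True
      have "2 = log 2 (4 :: real)" using log2_of_power_eq[of 4 2] by simp
      also have "\<dots> \<le> log 2 b" using True by (intro log_mono) auto
      finally show ?thesis using small by simp
    next
      case False
      then have "real (Suc k) \<le> 4" using Suc.prems(3) by simp
      then show ?thesis using log_b by linarith
    qed
  qed
  then obtain \<gamma>' where \<gamma>': "cycle_in K \<gamma>'" "simplices \<gamma>' 1 \<subseteq> E"
      "Suc k * len \<gamma>' \<le> 4 * log 2 b * card E"
    using short_cycle[OF K V Suc.prems(1) _ Suc.prems(2), of "4 * log 2 b"] by auto
  have "simplices \<gamma>' 1 \<noteq> {}"
  proof -
    obtain vs where vs: "3 \<le> length vs" "distinct vs" "\<gamma>' = closed_path_complex vs"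
      using \<gamma>'(1) by (auto simp: cycle_in_def)
    then have "0 < length vs" by linarith
    then show ?thesis using simplices_closed_path[OF vs(2,1)] by (auto simp: vs(3))
  qed
  then obtain e where e: "e \<in> simplices \<gamma>' 1" by blast
  then have "e \<in> E" using \<gamma>'(2) by blast
  have "E - {e} \<subseteq> simplices K 1" "k \<le> b" using Suc.prems by auto
  moreover have "card (\<Union>K) + k \<le> card (E - {e}) + 1"
    using Suc.prems(2) \<open>e \<in> E\<close> finE card_gt_0_iff[of E] by (auto simp: card_Diff_singleton)
  ultimately obtain \<gamma> :: "nat \<Rightarrow> 'a set set" where \<gamma>:
      "\<And>i. i \<in> {1..k} \<Longrightarrow> cycle_in K (\<gamma> i) \<and> simplices (\<gamma> i) 1 \<subseteq> E - {e}"
      "inj_on (\<lambda>i. fundamental_class (\<gamma> i)) {1..k}"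
      "Z2.independent ((\<lambda>i. fundamental_class (\<gamma> i)) ` {1..k})"
      "(\<Prod>i=1..k. real (len (\<gamma> i))) \<le> (4 * log 2 b * len K) ^ k / fact k"
    using Suc.IH[of "E - {e}"] by blast
  define \<gamma>\<^sub>1 where "\<gamma>\<^sub>1 = \<gamma>(Suc k := \<gamma>')"
  have old: "\<gamma>\<^sub>1 i = \<gamma> i" if "i \<in> {1..k}" for i using that by (simp add: \<gamma>\<^sub>1_def)
  have new: "\<gamma>\<^sub>1 (Suc k) = \<gamma>'" by (simp add: \<gamma>\<^sub>1_def)
  have old_img: "(\<lambda>i. fundamental_class (\<gamma>\<^sub>1 i)) ` {1..k} = (\<lambda>i. fundamental_class (\<gamma> i)) ` {1..k}"
    by (intro image_cong refl) (simp add: old)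
  have ins: "{1..Suc k} = insert (Suc k) {1..k}" and diff: "{1..k} - {Suc k} = {1..k}" by auto
  \<comment> \<open>Evaluation at the deleted edge \<open>e\<close> is a linear functional that
    vanishes on the other classes and is 1 on the class of the new cycle.\<close>
  have "Z2.span ((\<lambda>i. fundamental_class (\<gamma> i)) ` {1..k}) \<subseteq> {c. c e = 0}"
  proof (rule Z2.span_minimal)
    show "(\<lambda>i. fundamental_class (\<gamma> i)) ` {1..k} \<subseteq> {c. c e = 0}"
      using \<gamma>(1) by (fastforce simp: fundamental_class_def)
    show "Z2.subspace {c. c e = 0}" by (rule Z2.subspaceI) auto
  qed
  moreover have "fundamental_class \<gamma>' e = 1" using e by (simp add: fundamental_class_def)
  ultimately have notin: "fundamental_class \<gamma>' \<notin> Z2.span ((\<lambda>i. fundamental_class (\<gamma> i)) ` {1..k})"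
    by auto
  show ?case
  proof (intro exI[of _ \<gamma>\<^sub>1] conjI ballI)
    fix i assume "i \<in> {1..Suc k}"
    then consider "i = Suc k" | "i \<in> {1..k}" unfolding ins by blast
    then have "cycle_in K (\<gamma>\<^sub>1 i) \<and> simplices (\<gamma>\<^sub>1 i) 1 \<subseteq> E"
    proof cases
      case 1
      with \<gamma>' new show ?thesis by simp
    next
      case 2
      with \<gamma>(1)[OF 2] old[OF 2] show ?thesis by auto
    qed
    then show "cycle_in K (\<gamma>\<^sub>1 i)" "simplices (\<gamma>\<^sub>1 i) 1 \<subseteq> E" by auto
  next
    have "inj_on (\<lambda>i. fundamental_class (\<gamma>\<^sub>1 i)) {1..k}"
      using \<gamma>(2) by (rule inj_on_cong[THEN iffD1, rotated]) (simp add: old)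
    moreover have "fundamental_class \<gamma>' \<notin> (\<lambda>i. fundamental_class (\<gamma> i)) ` {1..k}"
      using notin by (rule contra_subsetD[OF Z2.span_superset])
    ultimately show "inj_on (\<lambda>i. fundamental_class (\<gamma>\<^sub>1 i)) {1..Suc k}"
      unfolding ins inj_on_insert new diff old_img by (rule conjI)
    show "Z2.independent ((\<lambda>i. fundamental_class (\<gamma>\<^sub>1 i)) ` {1..Suc k})"
      unfolding ins image_insert new old_img using notin \<gamma>(3) by (rule Z2.independent_insertI)
    have "len \<gamma>' \<le> 4 * log 2 b * len K / Suc k"
    proof -
      have "card E \<le> len K" unfolding len_def using fin Suc.prems(1) by (rule card_mono)
      then have "4 * log 2 b * card E \<le> 4 * log 2 b * len K" using log_b by (intro mult_left_mono) auto
      then show ?thesis using \<gamma>'(3) by (simp add: field_simps)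
    qed
    then have "(\<Prod>i=1..k. real (len (\<gamma> i))) * len \<gamma>'
        \<le> (4 * log 2 b * len K) ^ k / fact k * (4 * log 2 b * len K / Suc k)"
      using \<gamma>(4) log_b by (intro mult_mono) auto
    moreover have "(\<Prod>i=1..k. real (len (\<gamma>\<^sub>1 i))) = (\<Prod>i=1..k. real (len (\<gamma> i)))"
      by (intro prod.cong refl) (simp add: old)
    ultimately show "(\<Prod>i=1..Suc k. real (len (\<gamma>\<^sub>1 i))) \<le> (4 * log 2 b * len K) ^ Suc k / fact (Suc k)"
      by (simp add: new algebra_simps)
  qed
qed

theorem theorem1p7:
  fixes \<Gamma> :: "'a set set" and b :: nat
  assumes "connected_graph \<Gamma>"
    and "b = betti1 \<Gamma>"
    and "b \<ge> 2"
  shows "\<exists>\<gamma> :: nat \<Rightarrow> 'a set set.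
           (\<forall>k\<in>{1..b}. cycle_in \<Gamma> (\<gamma> k)) \<and>
           is_basis_of (\<lambda>k. fundamental_class (\<gamma> k)) {1..b} (H1 \<Gamma>) \<and>
           (\<Prod>k=1..b. real (len (\<gamma> k)))
             \<le> (4 * exp 1 * log 2 (real b)) ^ b * (real (len \<Gamma>) / real b) ^ b"
proof -
  have K: "simplicial_complex \<Gamma>" and "simplices \<Gamma> 1 \<noteq> {}"
    using assms(1) by (auto simp: connected_graph_def graph_def)
  then have V: "\<Union>\<Gamma> \<noteq> {}" by (fastforce simp: simplices_def)
  have card: "card (\<Union>\<Gamma>) + b \<le> card (simplices \<Gamma> 1) + 1"
    using betti1_le[OF assms(1)] assms(2) by simp
  obtain \<gamma> :: "nat \<Rightarrow> 'a set set" where \<gamma>: "\<And>i. i \<in> {1..b} \<Longrightarrow> cycle_in \<Gamma> (\<gamma> i)"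
      "inj_on (\<lambda>i. fundamental_class (\<gamma> i)) {1..b}"
      "Z2.independent ((\<lambda>i. fundamental_class (\<gamma> i)) ` {1..b})"
      "(\<Prod>i=1..b. real (len (\<gamma> i))) \<le> (4 * log 2 b * len \<Gamma>) ^ b / fact b"
    using greedy_cycles[OF K V assms(3) order_refl card order_refl] by blast
  define A where "A = (\<lambda>i. fundamental_class (\<gamma> i)) ` {1..b}"
  have A: "A \<subseteq> H1 \<Gamma>" "Z2.independent A" "finite A" "card A = b"
    using \<gamma> fundamental_class_in_H1[OF K] by (auto simp: A_def card_image)
  have "Z2.span A = H1 \<Gamma>"
  proof
    show "Z2.span A \<subseteq> H1 \<Gamma>" using A(1) subspace_H1 by (rule Z2.span_minimal)
    show "H1 \<Gamma> \<subseteq> Z2.span A"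
    proof (rule ccontr)
      assume "\<not> H1 \<Gamma> \<subseteq> Z2.span A"
      then obtain x where x: "x \<in> H1 \<Gamma>" "x \<notin> Z2.span A" by blast
      \<comment> \<open>A class outside the span would give \<open>b + 1\<close> independent
        elements in a space spanned by \<open>b\<close>.\<close>
      then have "Z2.independent (insert x A)" using A(2) by (intro Z2.independent_insertI)
      obtain B where B: "B \<subseteq> H1 \<Gamma>" "Z2.independent B" "H1 \<Gamma> \<subseteq> Z2.span B" "card B = b"
        using Z2.basis_exists[of "H1 \<Gamma>"] assms(2) by (metis betti1_def)
      have "card (insert x A) \<le> card B"
        using finite_independent_H1[OF assms(1) B(1,2)] \<open>Z2.independent (insert x A)\<close> A(1) B(3) x(1)
        by (intro conjunct2[OF Z2.independent_span_bound]) auto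
      moreover have "x \<notin> A" using x(2) by (rule contra_subsetD[OF Z2.span_superset])
      ultimately show False using A(3,4) B(4) by simp
    qed
  qed
  then have "is_basis_of (\<lambda>k. fundamental_class (\<gamma> k)) {1..b} (H1 \<Gamma>)"
    using \<gamma>(2,3) by (simp add: is_basis_of_def A_def)
  moreover have "(4 * log 2 b * len \<Gamma>) ^ b / fact b \<le> (4 * exp 1 * log 2 b) ^ b * (len \<Gamma> / b) ^ b"
  proof -
    have "0 < real b" using assms(3) by simp
    \<comment> \<open>The lower bound \<open>(b / exp 1) ^ b\<close> for \<open>fact b\<close>
      brings in both the factor \<open>exp 1\<close> and the division by \<open>b\<close>.\<close>
    have "(4 * log 2 b * len \<Gamma>) ^ b / fact b \<le> (4 * log 2 b * len \<Gamma>) ^ b / (b / exp 1) ^ b"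
      using fact_ge_power[of b] assms(3) by (intro divide_left_mono) (auto intro!: mult_pos_pos)
    also have "\<dots> = (4 * log 2 b * len \<Gamma> / (b / exp 1)) ^ b"
      by (simp only: power_divide)
    also have "4 * log 2 b * len \<Gamma> / (b / exp 1) = (4 * exp 1 * log 2 b) * (len \<Gamma> / b)"
      using \<open>0 < real b\<close> by (simp add: field_simps)
    finally show ?thesis by (simp only: power_mult_distrib)
  qed
  ultimately show ?thesis
    using \<gamma>(1) order_trans[OF \<gamma>(4)] by (intro exI[of _ \<gamma>] conjI ballI)
qed

end
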